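(* Let $f=F_1+F$ and $g=G_1+G$ with $F_1(0,0)=F(0,0)=0$, $G_1(0,0)=G(0,0)=0$, and put $\bar\kappa=\lfloor(1-\hat\delta)^{-1}\rfloor+1$. Suppose that: (i) there is a constant $\bar L$, and for any $R>0$ a constant $\bar L_R$ depending on $R$, such that $|F_1(x_1,y_1)-F_1(x_2,y_2)|^2\vee|G_1(x_1,y_1)-G_1(x_2,y_2)|^2\le\bar L(|x_1-x_2|^2+|y_1-y_2|^2)$ for all $x_1,x_2,y_1,y_2\in\mathbb R^d$, and $|F(x_1,y_1)-F(x_2,y_2)|^2\vee|G(x_1,y_1)-G(x_2,y_2)|^2\le\bar L_R(|x_1-x_2|^2+|y_1-y_2|^2)$ for all $x_1,x_2,y_1,y_2\in\mathbb R^d$ with $|x_1|\vee|x_2|\vee|y_1|\vee|y_2|\le R$; (ii) there are $\theta\in[0,\infty]$, nonnegative constants $\lambda_1,\lambda_2,\alpha_1,\alpha_2,\alpha_3,\alpha_4$ and $\beta>2$ such that for all $x,y\in\mathbb R^d$ $$2\langle x,F_1(x,y)\rangle+(1+\theta)|G_1(x,y)|^2\le-\lambda_1|x|^2+\lambda_2|y|^2,$$ $$2\langle x,F(x,y)\rangle+(1+\theta^{-1})|G(x,y)|^2\le\alpha_1|x|^2+\alpha_2|y|^2-\alpha_3|x|^\beta+\alpha_4|y|^\beta;$$ (iii) $\delta:[0,\infty)\to[0,\tau]$ is continuously differentiable and $|\delta'(t)|\le\hat\delta$ for all $t\ge0$, where $\hat\delta\in[0,1)$; (iv) $\lambda_1>\alpha_1+\frac14\lambda_2+\bar\kappa(\lambda_2+\alpha_2)$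 and $\alpha_3>\bar\kappa\alpha_4\ge0$. Let $\epsilon_\Delta=(4\bar L+2\bar L_1)\Delta+8(\varphi(\Delta))^2\Delta$ (where $\bar L_1$ is $\bar L_R$ with $R=1$), and choose $\Delta^\star\in(0,1]$ satisfying $$\epsilon_{\Delta^\star}=\frac{\lambda_1-\alpha_1-\frac14\lambda_2-\bar\kappa(\alpha_2+\lambda_2)}{1+\bar\kappa}.$$ Then for any admissible step size $\Delta\in(0,\Delta^\star)$ and any initial data $\xi\in C([-\tau,0];\mathbb R^d)$, the partially truncated EM approximation $\{y_k\}_{k\ge0}$ satisfies $$\limsup_{k\to\infty}\frac{\log\mathbb E|y_k|^2}{t_k}\le-\left(\gamma_\Delta^\star\wedge\frac1\tau\log\frac{\alpha_3}{\bar\kappa\,\alpha_4}\right),$$ where $\gamma^\star_\Delta$ is the unique root of $$\lambda_1=\Big(\alpha_1+\frac14\lambda_2+\epsilon_\Delta\Big)+\bar\kappa(\lambda_2+\alpha_2+\epsilon_\Delta)e^{\gamma^\star_\Delta\tau}+\frac{1-e^{-\gamma^\star_\Delta\Delta}}{\Delta}.$$ Moreover, $\lim_{\Delta\to0}\gamma^\star_\Delta=\gamma^\star$, where $\gamma^\star>0$ is the unique root of $$\lambda_1=\Big(\alpha_1+\frac14\lambda_2\Big)+\bar\kappa(\lambda_2+\alpha_2)e^{\gamma^\star\tau}+\gamma^\star,$$ and $$\int_0^\infty\mathbb E|Z_1(s)|^2\,ds<\infty.$$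
   Context: Let $(\Omega,\mathcal F,\mathbb P)$ be a complete probability space with a filtration $\{\mathcal F_t\}_{t\ge0}$ satisfying the usual conditions, and $B$ an $m$-dimensional Brownian motion with respect to it. $|\cdot|$ is the Euclidean norm for vectors and $|A|=\sqrt{\mathrm{trace}(A^TA)}$ for matrices; $a\vee b=\max(a,b)$, $a\wedge b=\min(a,b)$; $\lfloor\cdot\rfloor$ is the floor function. Let $\tau>0$, $F_1,F:\mathbb R^d\times\mathbb R^d\to\mathbb R^d$, $G_1,G:\mathbb R^d\times\mathbb R^d\to\mathbb R^{d\times m}$, $\delta:[0,\infty)\to[0,\tau]$ the delay function. The underlying equation is $dX(t)=f(X(t),X(t-\delta(t)))dt+g(X(t),X(t-\delta(t)))dB(t)$, $t\ge0$, with initial data $X=\xi$ on $[-\tau,0]$. Convention on $\theta$: when $\theta=0$, set $\theta^{-1}|G(x,y)|^2=0$; when $\theta=\infty$, set $\theta|G_1(x,y)|^2=0$ (and $\theta^{-1}=0$). If $\alpha_4=0$, $\log\frac{\alpha_3}{\bar\kappa\alpha_4}$ is read as $+\infty$. Truncation. Fix a strictly increasing continuous $\mu:\mathbb R_+\to\mathbb R_+$ with $\mu(R)\to\infty$ as $R\to\infty$ and $$\sup_{|x|\vee|y|\le r}\left(\frac{|f(x,y)|}{1+|x|+|y|}\vee\frac{|g(x,y)|}{1+|x|+|y|}\right)\le\mu(r),\quad r\ge1,$$ with inverse $\mu^{-1}:[\mu(1),\infty)\to\mathbb R_+$; a constant $\hat h\ge1\vee\mu(1)$; and a strictly decreasing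 $\varphi:(0,1]\to[\mu(1),\infty)$ with $\lim_{\Delta\to0}\varphi(\Delta)=\infty$ and $\Delta^{1/4}\varphi(\Delta)\le\hat h$ for all $\Delta\in(0,1]$. Put $\pi_\Delta(x)=\big(|x|\wedge\mu^{-1}(\varphi(\Delta))\big)\frac{x}{|x|}$ (with $x/|x|=0$ if $x=0$). The partially truncated coefficients are $$f_\Delta(x,y)=F_1(x,y)+F(\pi_\Delta(x),\pi_\Delta(y)),\qquad g_\Delta(x,y)=G_1(x,y)+G(\pi_\Delta(x),\pi_\Delta(y)).$$ Scheme (partially truncated Euler–Maruyama). An admissible step size is $\Delta\in(0,1]$ of the form $\Delta=\tau/M$, $M$ a positive integer. Let $t_k=k\Delta$, $\delta_k=\lfloor\delta(k\Delta)/\Delta\rfloor$ for $k\ge0$, $\Delta B_k=B(t_{k+1})-B(t_k)$, and $$y_{k+1}=y_k+f_\Delta(y_k,y_{k-\delta_k})\Delta+g_\Delta(y_k,y_{k-\delta_k})\Delta B_k,\ k\ge0,\qquad y_k=\xi(t_k),\ k=-M,\dots,0.$$ $Z_1(t)=y_k$ for $t\in[t_k,t_{k+1})$, $k\ge-M$.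
   Formalization: Δ* is taken to be the smallest solution of its equation (for a later solution the claim can fail), and θ=0 (resp. θ=∞) is allowed only when G (resp. G_1) vanishes identically, since merely dropping the term leaves the mixed term of |G_1+G|² uncontrolled and the claim false. *)

theory Defs
  imports "HOL-Probability.Probability"
begin

text \<open>Vectors are \<open>real ^ 'd\<close> and \<open>d \<times> m\<close> matrices are \<open>real ^ 'm ^ 'd\<close>, so that \<open>A *v w\<close> maps
  \<open>real ^ 'm\<close> to \<open>real ^ 'd\<close>. On matrices the library norm is the trace norm:\<close>

lemma norm_matrix_trace:
  fixes A :: "real ^ 'm ^ 'd"
  shows "norm A = sqrt (trace (transpose A ** A))"
proof -
  have "trace (transpose A ** A) = (\<Sum>j\<in>UNIV. \<Sum>i\<in>UNIV. (A $ i $ j)\<^sup>2)"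
    by (simp add: trace_def matrix_matrix_mult_def transpose_def power2_eq_square)
  also have "\<dots> = (\<Sum>i\<in>UNIV. \<Sum>j\<in>UNIV. (A $ i $ j)\<^sup>2)"
    by (rule sum.swap)
  also have "\<dots> = A \<bullet> A"
    by (simp add: inner_vec_def power2_eq_square)
  finally show ?thesis
    by (simp add: norm_eq_sqrt_inner)
qed

text \<open>Only the times \<open>t \<ge> 0\<close> of a filtration matter; \<open>null_sets M\<close> is the full family of null sets
  when \<open>M\<close> is complete.\<close>

definition usual_filtration :: "'a measure \<Rightarrow> (real \<Rightarrow> 'a measure) \<Rightarrow> bool" where
  "usual_filtration M \<F> \<longleftrightarrow>
     (\<forall>t\<ge>0. subalgebra M (\<F> t)) \<and>
     (\<forall>s t. 0 \<le> s \<and> s \<le> t \<longrightarrow> sets (\<F> s) \<subseteq> sets (\<F> t)) \<and>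
     (\<forall>t\<ge>0. (\<Inter>s\<in>{t<..}. sets (\<F> s)) = sets (\<F> t)) \<and>
     null_sets M \<subseteq> sets (\<F> 0)"

text \<open>The second argument of \<^const>\<open>normal_density\<close> is the standard deviation.\<close>

definition brownian_motion ::
    "'a measure \<Rightarrow> (real \<Rightarrow> 'a measure) \<Rightarrow> (real \<Rightarrow> 'a \<Rightarrow> real ^ 'm) \<Rightarrow> bool" where
  "brownian_motion M \<F> B \<longleftrightarrow>
     (\<forall>t\<ge>0. B t \<in> borel_measurable (\<F> t)) \<and>
     (AE \<omega> in M. B 0 \<omega> = 0) \<and>
     (AE \<omega> in M. continuous_on {0..} (\<lambda>t. B t \<omega>)) \<and>
     (\<forall>s t. 0 \<le> s \<and> s < t \<longrightarrow>
        prob_space.indep_set M (sets (\<F> s))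
          (sets (vimage_algebra (space M) (\<lambda>\<omega>. B t \<omega> - B s \<omega>) borel)) \<and>
        prob_space.indep_vars M (\<lambda>_. borel) (\<lambda>i \<omega>. (B t \<omega> - B s \<omega>) $ i) UNIV \<and>
        (\<forall>i. distributed M lborel (\<lambda>\<omega>. (B t \<omega> - B s \<omega>) $ i) (normal_density 0 (sqrt (t - s)))))"

text \<open>Truncation at radius \<open>\<rho>\<close>; \<open>sgn x\<close> is \<open>x / |x|\<close>, and \<open>0\<close> for \<open>x = 0\<close>.\<close>

definition trunc :: "real \<Rightarrow> real ^ 'd \<Rightarrow> real ^ 'd" where
  "trunc \<rho> x = min (norm x) \<rho> *\<^sub>R sgn x"

definition partial_trunc ::
    "(real ^ 'd \<Rightarrow> real ^ 'd \<Rightarrow> 'b::plus) \<Rightarrow> (real ^ 'd \<Rightarrow> real ^ 'd \<Rightarrow> 'b) \<Rightarrow> real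
       \<Rightarrow> real ^ 'd \<Rightarrow> real ^ 'd \<Rightarrow> 'b" where
  "partial_trunc H\<^sub>1 H \<rho> x y = H\<^sub>1 x y + H (trunc \<rho> x) (trunc \<rho> y)"

text \<open>\<open>\<delta>\<close> is nonnegative on \<open>[0, \<infinity>)\<close>, so \<^const>\<open>nat\<close> truncates nothing there.\<close>

definition delay_steps :: "(real \<Rightarrow> real) \<Rightarrow> real \<Rightarrow> int \<Rightarrow> nat" where
  "delay_steps \<delta> h k = nat \<lfloor>\<delta> (of_int k * h) / h\<rfloor>"

text \<open>Euler--Maruyama iterates with step \<open>h\<close>, drift \<open>a\<close>, diffusion \<open>b\<close> and initial segment \<open>\<xi>\<close>
  along one path \<open>w\<close> of the driving noise; the time index ranges over the integers because the
  initial segment occupies \<open>k \<le> 0\<close>. Only the indices \<open>k \<ge> -\<tau>/h\<close> are ever reached.\<close>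

function em_scheme ::
    "(real ^ 'd \<Rightarrow> real ^ 'd \<Rightarrow> real ^ 'd) \<Rightarrow> (real ^ 'd \<Rightarrow> real ^ 'd \<Rightarrow> real ^ 'm ^ 'd) \<Rightarrow>
     (real \<Rightarrow> real) \<Rightarrow> (real \<Rightarrow> real ^ 'd) \<Rightarrow> real \<Rightarrow> (real \<Rightarrow> real ^ 'm) \<Rightarrow> int \<Rightarrow> real ^ 'd" where
  "em_scheme a b \<delta> \<xi> h w n =
     (if n \<le> 0 then \<xi> (of_int n * h)
      else let k = n - 1;
               x = em_scheme a b \<delta> \<xi> h w k;
               y = em_scheme a b \<delta> \<xi> h w (k - int (delay_steps \<delta> h k))
           in x + h *\<^sub>R a x y + b x y *v (w (of_int (k + 1) * h) - w (of_int k * h)))"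
  by pat_completeness auto
termination
  by (relation "Wellfounded.measure (\<lambda>(a, b, \<delta>, \<xi>, h, w, n). nat n)") auto

declare em_scheme.simps [simp del]

lemma em_scheme_initial: "k \<le> 0 \<Longrightarrow> em_scheme a b \<delta> \<xi> h w k = \<xi> (of_int k * h)"
  by (simp add: em_scheme.simps)

lemma em_scheme_step:
  assumes "0 \<le> k"
  shows "em_scheme a b \<delta> \<xi> h w (k + 1) =
    em_scheme a b \<delta> \<xi> h w k
    + h *\<^sub>R a (em_scheme a b \<delta> \<xi> h w k) (em_scheme a b \<delta> \<xi> h w (k - int (delay_steps \<delta> h k)))
    + b (em_scheme a b \<delta> \<xi> h w k) (em_scheme a b \<delta> \<xi> h w (k - int (delay_steps \<delta> h k)))
        *v (w (of_int (k + 1) * h) - w (of_int k * h))"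
  using assms by (subst em_scheme.simps) (simp add: Let_def)

definition admissible_step :: "real \<Rightarrow> real \<Rightarrow> bool" where
  "admissible_step \<tau> h \<longleftrightarrow> 0 < h \<and> h \<le> 1 \<and> (\<exists>N::nat. 0 < N \<and> h = \<tau> / real N)"

text \<open>Second moments are taken in \<open>[0, \<infinity>]\<close>, so no integrability is presupposed, and the logarithm
  is extended to \<open>[0, \<infinity>]\<close> because the library has \<open>ln 0 = 0\<close>.\<close>

definition second_moment :: "'a measure \<Rightarrow> ('a \<Rightarrow> real ^ 'd) \<Rightarrow> ennreal" where
  "second_moment M X = (\<integral>\<^sup>+ \<omega>. ennreal ((norm (X \<omega>))\<^sup>2) \<partial>M)"

definition ln_ennreal :: "ennreal \<Rightarrow> ereal" where
  "ln_ennreal u = (if u = 0 then -\<infinity> else if u = \<infinity> then \<infinity> else ereal (ln (enn2real u)))"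

text \<open>Growth condition with a weight \<open>c \<in> [0, \<infinity>]\<close> (\<open>1 + \<theta>\<close> or \<open>1 + \<theta>\<inverse>\<close>, with \<open>\<theta> \<in> [0, \<infinity>]\<close>) on the
  diffusion term. In \<^typ>\<open>ereal\<close> one has \<open>inverse 0 = \<infinity>\<close>, \<open>inverse \<infinity> = 0\<close> and \<open>\<infinity> * 0 = 0\<close>. Hence
  at \<open>\<theta> = 0\<close> the term \<open>\<theta>\<inverse> |G|\<^sup>2\<close> is \<open>0\<close> for \<open>G = 0\<close>, and at \<open>\<theta> = \<infinity>\<close> the term \<open>\<theta> |G\<^sub>1|\<^sup>2\<close> is \<open>0\<close> for
  \<open>G\<^sub>1 = 0\<close>; where the diffusion does not vanish the infinite weight makes the condition fail.
  So \<open>\<theta> = 0\<close> and \<open>\<theta> = \<infinity>\<close> stand for the cases of no \<open>G\<close> term and no \<open>G\<^sub>1\<close> term; without this the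
  mixed term in \<open>|G\<^sub>1 + G|\<^sup>2\<close> would be uncontrolled.\<close>

definition growth_bound ::
    "ereal \<Rightarrow> (real ^ 'd \<Rightarrow> real ^ 'd \<Rightarrow> real ^ 'd) \<Rightarrow> (real ^ 'd \<Rightarrow> real ^ 'd \<Rightarrow> real ^ 'm ^ 'd) \<Rightarrow>
     (real ^ 'd \<Rightarrow> real ^ 'd \<Rightarrow> real) \<Rightarrow> bool" where
  "growth_bound c a b V \<longleftrightarrow>
     (\<forall>x y. ereal (2 * (x \<bullet> a x y)) + c * ereal ((norm (b x y))\<^sup>2) \<le> ereal (V x y))"

end

theory Submission
  imports Defs
begin

text \<open>
  Write \<open>w\<^sub>k\<close> for the second moment of \<open>y\<^sub>k\<close>. The Brownian increment is independent of the past and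
  centred, so one step gives
  \<open>w\<^sub>k\<^sub>+\<^sub>1 = w\<^sub>k + h E(2 \<langle>x, f\<^sub>\<Delta>\<rangle> + |g\<^sub>\<Delta>|\<^sup>2 + h |f\<^sub>\<Delta>|\<^sup>2)\<close> at \<open>x = y\<^sub>k\<close>
  (\<open>second_moment_add_noise\<close>). By the truncation, \<open>h |f\<^sub>\<Delta>(x, y)|\<^sup>2 \<le> \<epsilon>\<^sub>h (|x|\<^sup>2 + |y|\<^sup>2)\<close>
  (\<open>partial_trunc_drift_bound\<close>), and the growth conditions turn the recursion into a delayed
  linear inequality for \<open>w\<close>, with moments of order \<open>\<beta>\<close> of the truncated values as further terms.

  The growth condition on \<open>F\<close> and \<open>G\<close> does not simply survive the truncation. For \<open>|x| > \<rho>\<close> the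
  bound at the truncated point is multiplied by \<open>|x| / \<rho>\<close>, which may enlarge the term
  \<open>\<alpha>\<^sub>2 |y|\<^sup>2\<close>. There are two regimes.

  If \<open>\<alpha>\<^sub>3 \<rho>\<^sup>\<beta> \<ge> \<alpha>\<^sub>2 \<rho>\<^sup>2 + \<alpha>\<^sub>4 \<rho>\<^sup>\<beta>\<close>, then what is enlarged, apart from
  the term with \<open>\<alpha>\<^sub>1\<close>, is nonpositive and the bound persists
  (\<open>trunc_growth_dissipative\<close>). The terms of order \<open>\<beta>\<close> can only be balanced over time: multiply by
  \<open>exp(\<gamma> t)\<close>, sum over \<open>k\<close>, and use that at most \<open>\<kappa>\<close> indices share the same delayed index
  (\<open>summed_decay\<close>, \<open>delay_fibre_card_le\<close>).

  Otherwise the power \<open>\<alpha>\<^sub>4 |y|\<^sup>\<beta>\<close> is dominated by a quadratic term inside the ball, and there is a bound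
  \<open>(\<alpha>\<^sub>1 + \<eta>) |x|\<^sup>2 + q |y|\<^sup>2\<close> with \<open>\<eta> + q = \<kappa> \<alpha>\<^sub>2\<close> (\<open>trunc_growth_quadratic\<close>). Now no term of order
  \<open>\<beta>\<close> is left, so a Halanay induction applies, in which each delayed value counts once instead of
  \<open>\<kappa>\<close> times (\<open>halanay_decay\<close>); since \<open>\<kappa> \<ge> 2\<close>, this saving pays for \<open>\<eta>\<close>.

  In both regimes \<open>w\<^sub>k\<close> is bounded by a multiple of \<open>exp(- \<gamma> t\<^sub>k)\<close>, where \<open>\<gamma>\<close> is the minimum in the claim;
  this gives the upper limit and the integral. The roots exist, are unique and converge by
  monotonicity in \<open>\<gamma>\<close>, once \<open>\<epsilon>\<^sub>h\<close> is known to stay below its threshold for all \<open>h\<close> before the first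
  solution (\<open>below_level_before_first_hit\<close>).
\<close>

section \<open>The threshold for the step size\<close>

text \<open>As a monotone function may jump, \<open>E\<close> need not be continuous. But \<open>E h / h\<close> decreases, so all
  jumps of \<open>E\<close> go downwards, and an upward passage through the level \<open>v\<close> has to hit it.\<close>

lemma below_level_before_first_hit:
  fixes E :: "real \<Rightarrow> real"
  assumes ratio: "\<And>s t. \<lbrakk>0 < s; s \<le> t; t < d\<rbrakk> \<Longrightarrow> s * E t \<le> t * E s"
    and lim: "(E \<longlongrightarrow> 0) (at_right 0)" and v: "0 < v"
    and no_hit: "\<And>t. \<lbrakk>0 < t; t < d\<rbrakk> \<Longrightarrow> E t \<noteq> v"
    and h: "0 < h" "h < d"
  shows "E h < v"
proof (rule ccontr)
  assume "\<not> E h < v"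
  with no_hit h have Eh: "v < E h" by force
  define S where "S = {t. 0 < t \<and> t \<le> h \<and> E t < v}"
  have "eventually (\<lambda>t. E t < v) (at_right 0)"
    using lim v by (rule order_tendstoD)
  moreover have "eventually (\<lambda>t. t \<in> {0<..<h}) (at_right 0)"
    using h(1) by (rule eventually_at_right_real)
  ultimately have "eventually (\<lambda>t. E t < v \<and> t \<in> {0<..<h}) (at_right 0)"
    by (rule eventually_conj)
  then obtain t0 where "E t0 < v" "t0 \<in> {0<..<h}"
    using eventually_happens[of _ "at_right (0::real)"] by fastforce
  then have t0: "t0 \<in> S" by (simp add: S_def)
  have bdd: "bdd_above S" by (auto simp: S_def bdd_above_def)
  define s where "s = Sup S"
  have s_upper: "t \<le> s" if "t \<in> S" for t
    unfolding s_def using that bdd by (rule cSup_upper)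
  have s_pos: "0 < s" using s_upper[OF t0] t0 by (simp add: S_def)
  have s_le: "s \<le> h" unfolding s_def using t0 by (intro cSup_least) (auto simp: S_def)
  have "E s \<le> v"
  proof (rule ccontr)
    assume "\<not> E s \<le> v"
    then have Es: "v < E s" by simp
    have "t \<le> v * s / E s" if "t \<in> S" for t
    proof -
      from that have t: "0 < t" "E t < v" "t \<le> s" using s_upper by (auto simp: S_def)
      have "t * E s \<le> s * E t" using t s_le h by (intro ratio) auto
      also have "\<dots> \<le> s * v" using t s_pos by (intro mult_left_mono) auto
      finally show ?thesis using Es v by (simp add: field_simps)
    qed
    then have "s \<le> v * s / E s" unfolding s_def using t0 by (intro cSup_least) auto
    then show False using Es v s_pos by (simp add: field_simps)
  qed
  with no_hit s_pos s_le h have Es: "E s < v" by force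
  with Eh s_le have s_less: "s < h" by (cases "s = h") auto
  have Es_pos: "0 < E s"
  proof -
    have "s * E h \<le> h * E s" using s_pos s_le h by (intro ratio) auto
    moreover have "0 < s * E h" using s_pos Eh v by simp
    ultimately show ?thesis using h by (metis less_le_trans zero_less_mult_pos)
  qed
  \<comment> \<open>The line through the origin and \<open>(s, E s)\<close> stays below \<open>v\<close> up to this point.\<close>
  define r where "r = s * v / E s"
  have r: "s < r" using s_pos Es Es_pos by (simp add: r_def field_simps)
  show False
  proof (cases "r \<le> h")
    case True
    have "s * E r \<le> r * E s" using s_pos r True h by (intro ratio) auto
    also have "\<dots> = s * v" using Es_pos by (simp add: r_def)
    finally have "E r \<le> v" using s_pos by simp
    with no_hit[of r] r s_pos True h have "E r < v" by force
    then have "r \<in> S" using r s_pos True by (simp add: S_def)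
    then show False using s_upper[of r] r by simp
  next
    case False
    have "s * E h \<le> h * E s" using s_pos s_le h by (intro ratio) auto
    also have "\<dots> < r * E s" using False Es_pos by simp
    also have "\<dots> = s * v" using Es_pos by (simp add: r_def)
    finally show False using s_pos Eh by simp
  qed
qed

text \<open>The step bound \<open>h\<^bsup>1/4\<^esup> \<phi>(h) \<le> H\<close> makes \<open>\<phi>(h)\<^sup>2 h\<close> of order \<open>h\<^bsup>1/2\<^esup>\<close>.\<close>

lemma step_error_tendsto_zero:
  fixes \<phi> :: "real \<Rightarrow> real"
  assumes "\<And>h. \<lbrakk>0 < h; h \<le> 1\<rbrakk> \<Longrightarrow> 0 \<le> \<phi> h" and "\<And>h. \<lbrakk>0 < h; h \<le> 1\<rbrakk> \<Longrightarrow> h powr (1/4) * \<phi> h \<le> H"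
    and "0 \<le> C"
  shows "((\<lambda>h. C * h + 8 * (\<phi> h)\<^sup>2 * h) \<longlongrightarrow> 0) (at_right 0)"
proof (rule tendsto_sandwich[of "\<lambda>_. 0" _ _ "\<lambda>h. C * h + 8 * H\<^sup>2 * sqrt h"])
  have ev: "eventually (\<lambda>h. h \<in> {0<..<1::real}) (at_right 0)" by (rule eventually_at_right_real) simp
  then show "eventually (\<lambda>h. 0 \<le> C * h + 8 * (\<phi> h)\<^sup>2 * h) (at_right 0)"
    by eventually_elim (use assms(3) in auto)
  show "eventually (\<lambda>h. C * h + 8 * (\<phi> h)\<^sup>2 * h \<le> C * h + 8 * H\<^sup>2 * sqrt h) (at_right 0)"
    using ev
  proof eventually_elim
    case (elim h)
    have quarter: "(h powr (1/4))\<^sup>2 = sqrt h"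
      using elim by (simp add: powr_half_sqrt[symmetric] power2_eq_square powr_add[symmetric])
    have "(h powr (1/4) * \<phi> h)\<^sup>2 \<le> H\<^sup>2"
      using assms(1,2)[of h] elim by (intro power_mono) auto
    then have "sqrt h * (\<phi> h)\<^sup>2 \<le> H\<^sup>2" by (simp add: power_mult_distrib quarter)
    then have "(sqrt h * (\<phi> h)\<^sup>2) * sqrt h \<le> H\<^sup>2 * sqrt h"
      using elim by (intro mult_right_mono) auto
    moreover have "(sqrt h * (\<phi> h)\<^sup>2) * sqrt h = (\<phi> h)\<^sup>2 * (sqrt h * sqrt h)" by (simp only: ac_simps)
    ultimately show ?case using elim by simp
  qed
  have "((\<lambda>h. C * h + 8 * H\<^sup>2 * sqrt h) \<longlongrightarrow> C * 0 + 8 * H\<^sup>2 * sqrt 0) (at_right 0)"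
    by (intro tendsto_intros)
  then show "((\<lambda>h. C * h + 8 * H\<^sup>2 * sqrt h) \<longlongrightarrow> 0) (at_right 0)" by simp
qed simp

section \<open>The characteristic equations\<close>

lemma ex1_root_strict_mono:
  fixes f :: "real \<Rightarrow> real"
  assumes "continuous_on UNIV f" and mono: "strict_mono f"
    and "f 0 < v" and "filterlim f at_top at_top"
  shows "\<exists>!x. v = f x" and "\<And>x. v = f x \<Longrightarrow> 0 < x"
proof -
  have "eventually (\<lambda>x. v \<le> f x) at_top"
    using assms(4) by (simp add: filterlim_at_top)
  then have "eventually (\<lambda>x. v \<le> f x \<and> 0 \<le> x) at_top"
    using eventually_ge_at_top[of 0] by (rule eventually_conj)
  then obtain b where "v \<le> f b" "0 \<le> b"
    using eventually_happens[of _ "at_top :: real filter"] by auto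
  then obtain x where x: "v = f x"
    using IVT'[of f 0 v b] assms(3) continuous_on_subset[OF assms(1)] by force
  show "\<exists>!x. v = f x"
  proof (rule ex1I)
    show "v = f x" by (rule x)
    fix y assume "v = f y"
    with x have "f y = f x" by simp
    then show "y = x" by (simp only: strict_mono_eq[OF mono])
  qed
  show "0 < x" if "v = f x" for x
    using assms(3) that strict_mono_less[OF mono, of 0 x] by simp
qed

lemma backward_rate_bounds:
  fixes h :: real
  assumes "0 < h"
  shows "strict_mono (\<lambda>\<gamma>. (1 - exp (- \<gamma> * h)) / h)"
    and "0 \<le> \<gamma> \<Longrightarrow> 0 \<le> (1 - exp (- \<gamma> * h)) / h"
  using assms by (auto simp: strict_mono_def divide_strict_right_mono)

lemma discrete_root_ex1:
  fixes a b h \<tau> v :: real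
  assumes "0 < h" "0 < b" "0 < \<tau>" and "a + b < v"
  shows "\<exists>!\<gamma>. v = a + b * exp (\<gamma> * \<tau>) + (1 - exp (- \<gamma> * h)) / h"
    and "\<And>\<gamma>. v = a + b * exp (\<gamma> * \<tau>) + (1 - exp (- \<gamma> * h)) / h \<Longrightarrow> 0 < \<gamma>"
proof -
  let ?f = "\<lambda>\<gamma>. a + b * exp (\<gamma> * \<tau>) + (1 - exp (- \<gamma> * h)) / h"
  have cont: "continuous_on UNIV ?f" using assms by (intro continuous_intros) auto
  have mono: "strict_mono ?f"
  proof (rule strict_monoI)
    fix x y :: real assume "x < y"
    then have "b * exp (x * \<tau>) < b * exp (y * \<tau>)" using assms by simp
    with strict_monoD[OF backward_rate_bounds(1)[OF assms(1)] \<open>x < y\<close>] show "?f x < ?f y" by simp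
  qed
  have "filterlim (\<lambda>\<gamma>. (a + b * \<tau> * \<gamma>)) at_top at_top"
    using assms by (intro filterlim_tendsto_add_at_top[OF tendsto_const]
      filterlim_tendsto_pos_mult_at_top[OF tendsto_const _ filterlim_ident]) auto
  moreover have "eventually (\<lambda>\<gamma>. a + b * \<tau> * \<gamma> \<le> ?f \<gamma>) at_top"
    using eventually_ge_at_top[of 0]
  proof eventually_elim
    case (elim \<gamma>)
    have "\<gamma> * \<tau> \<le> exp (\<gamma> * \<tau>)" using exp_ge_add_one_self[of "\<gamma> * \<tau>"] by linarith
    then have "b * (\<gamma> * \<tau>) \<le> b * exp (\<gamma> * \<tau>)" using assms by (intro mult_left_mono) auto
    with backward_rate_bounds(2)[OF assms(1) elim] show ?case by (simp add: ac_simps)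
  qed
  ultimately have top: "filterlim ?f at_top at_top" by (rule filterlim_at_top_mono)
  have "?f 0 < v" using assms by simp
  note r = ex1_root_strict_mono[OF cont mono this top]
  show "\<exists>!\<gamma>. v = ?f \<gamma>" by (rule r(1))
  show "\<And>\<gamma>. v = ?f \<gamma> \<Longrightarrow> 0 < \<gamma>" by (rule r(2))
qed

lemma continuous_root_ex1:
  fixes a b \<tau> v :: real
  assumes "0 \<le> b" "0 < \<tau>" and "a + b < v"
  shows "\<exists>!\<gamma>. v = a + b * exp (\<gamma> * \<tau>) + \<gamma>"
    and "\<And>\<gamma>. v = a + b * exp (\<gamma> * \<tau>) + \<gamma> \<Longrightarrow> 0 < \<gamma>"
proof -
  let ?f = "\<lambda>\<gamma>. a + b * exp (\<gamma> * \<tau>) + \<gamma>"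
  have cont: "continuous_on UNIV ?f" by (intro continuous_intros)
  have mono: "strict_mono ?f"
  proof (rule strict_monoI)
    fix x y :: real assume "x < y"
    then have "b * exp (x * \<tau>) \<le> b * exp (y * \<tau>)" using assms by (intro mult_left_mono) auto
    with \<open>x < y\<close> show "?f x < ?f y" by simp
  qed
  have "filterlim (\<lambda>\<gamma>. a + \<gamma>) at_top at_top"
    by (rule filterlim_tendsto_add_at_top[OF tendsto_const filterlim_ident])
  moreover have "eventually (\<lambda>\<gamma>. a + \<gamma> \<le> ?f \<gamma>) at_top"
    using assms by (intro always_eventually) auto
  ultimately have top: "filterlim ?f at_top at_top" by (rule filterlim_at_top_mono)
  have "?f 0 < v" using assms by simp
  note r = ex1_root_strict_mono[OF cont mono this top]
  show "\<exists>!\<gamma>. v = ?f \<gamma>" by (rule r(1))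
  show "\<And>\<gamma>. v = ?f \<gamma> \<Longrightarrow> 0 < \<gamma>" by (rule r(2))
qed

text \<open>Pointwise convergence suffices: the limit function separates every \<open>y \<noteq> x\<close> strictly from the
  level \<open>v\<close>, and by monotonicity this traps the roots.\<close>

lemma roots_of_monotone_tendsto:
  fixes f :: "real \<Rightarrow> real" and g :: "'b \<Rightarrow> real \<Rightarrow> real"
  assumes mono: "strict_mono f" and root: "f x = v"
    and conv: "\<And>y. ((\<lambda>h. g h y) \<longlongrightarrow> f y) A"
    and g: "eventually (\<lambda>h. strict_mono (g h) \<and> g h (r h) = v) A"
  shows "(r \<longlongrightarrow> x) A"
proof (rule order_tendstoI)
  fix y assume "y < x"
  then have "f y < v" using mono root by (auto simp: strict_mono_def)
  from order_tendstoD(2)[OF conv this] g show "eventually (\<lambda>h. y < r h) A"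
    by eventually_elim (auto dest: strict_mono_less[of _ y])
next
  fix y assume "x < y"
  then have "v < f y" using mono root by (auto simp: strict_mono_def)
  from order_tendstoD(1)[OF conv this] g show "eventually (\<lambda>h. r h < y) A"
    by eventually_elim (auto dest: strict_mono_less[of _ _ y])
qed

lemma backward_rate_tendsto:
  "((\<lambda>h. (1 - exp (- \<gamma> * h)) / h) \<longlongrightarrow> \<gamma>) (at_right (0::real))"
proof -
  have "((\<lambda>h. 1 - exp (- \<gamma> * h)) has_real_derivative \<gamma>) (at 0)"
    by (auto intro!: derivative_eq_intros)
  then have "((\<lambda>h. (1 - exp (- \<gamma> * h)) / h) \<longlongrightarrow> \<gamma>) (at 0)"
    by (simp add: has_field_derivative_iff)
  then show ?thesis by (rule filterlim_mono) (auto simp: at_le)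
qed

lemma discrete_roots_tendsto:
  fixes a b c \<tau> v \<gamma>\<^sub>0 d :: real and e r :: "real \<Rightarrow> real"
  assumes "0 < \<tau>" "0 \<le> b" "0 \<le> c" "0 < d" and e: "(e \<longlongrightarrow> 0) (at_right 0)"
    and e_nonneg: "\<And>h. \<lbrakk>0 < h; h < d\<rbrakk> \<Longrightarrow> 0 \<le> e h"
    and r: "\<And>h. \<lbrakk>0 < h; h < d\<rbrakk> \<Longrightarrow>
      v = (a + e h) + c * (b + e h) * exp (r h * \<tau>) + (1 - exp (- r h * h)) / h"
    and root: "v = a + c * b * exp (\<gamma>\<^sub>0 * \<tau>) + \<gamma>\<^sub>0"
  shows "(r \<longlongrightarrow> \<gamma>\<^sub>0) (at_right 0)"
proof (rule roots_of_monotone_tendsto[where v = v])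
  let ?f = "\<lambda>\<gamma>. a + c * b * exp (\<gamma> * \<tau>) + \<gamma>"
  let ?g = "\<lambda>h \<gamma>. (a + e h) + c * (b + e h) * exp (\<gamma> * \<tau>) + (1 - exp (- \<gamma> * h)) / h"
  show "strict_mono ?f"
  proof (rule strict_monoI)
    fix x y :: real assume "x < y"
    then have "c * b * exp (x * \<tau>) \<le> c * b * exp (y * \<tau>)"
      using assms by (intro mult_left_mono) auto
    with \<open>x < y\<close> show "?f x < ?f y" by simp
  qed
  show "?f \<gamma>\<^sub>0 = v" using root by simp
  show "((\<lambda>h. ?g h y) \<longlongrightarrow> ?f y) (at_right 0)" for y
  proof -
    have "((\<lambda>h. ?g h y) \<longlongrightarrow> (a + 0) + c * (b + 0) * exp (y * \<tau>) + y) (at_right 0)"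
      by (intro tendsto_intros e backward_rate_tendsto)
    then show ?thesis by simp
  qed
  have mono_g: "strict_mono (?g h)" if h: "0 < h" "h < d" for h
  proof (rule strict_monoI)
    fix x y :: real assume "x < y"
    then have "c * (b + e h) * exp (x * \<tau>) \<le> c * (b + e h) * exp (y * \<tau>)"
      using assms e_nonneg[OF h] by (intro mult_left_mono) auto
    with strict_monoD[OF backward_rate_bounds(1)[OF h(1)] \<open>x < y\<close>] show "?g h x < ?g h y" by simp
  qed
  have "eventually (\<lambda>h. h \<in> {0<..<d}) (at_right 0)"
    using \<open>0 < d\<close> by (rule eventually_at_right_real)
  then show "eventually (\<lambda>h. strict_mono (?g h) \<and> ?g h (r h) = v) (at_right 0)"
    by eventually_elim (use mono_g r in auto)
qed

section \<open>The truncation and the partially truncated coefficients\<close>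

lemma truncation_radius:
  fixes \<mu> :: "real \<Rightarrow> real" and v :: real
  assumes mono: "strict_mono_on {0..} \<mu>" and cont: "continuous_on {0..} \<mu>"
    and top: "filterlim \<mu> at_top at_top" and "\<mu> 1 \<le> v"
  defines "\<rho> \<equiv> the_inv_into {0..} \<mu> v"
  shows "1 \<le> \<rho>" "\<mu> \<rho> = v"
proof -
  have "eventually (\<lambda>r. v \<le> \<mu> r \<and> 1 \<le> r) at_top"
    using top by (intro eventually_conj eventually_ge_at_top) (simp add: filterlim_at_top)
  then obtain r where "v \<le> \<mu> r" "1 \<le> r"
    using eventually_happens[of _ "at_top :: real filter"] by auto
  then obtain s where s: "1 \<le> s" "\<mu> s = v"
    using IVT'[of \<mu> 1 v r] assms(4) continuous_on_subset[OF cont, of "{1..r}"] by auto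
  moreover have "\<rho> = s"
    unfolding \<rho>_def s(2)[symmetric] using s(1)
    by (intro the_inv_into_f_f strict_mono_on_imp_inj_on mono) auto
  ultimately show "1 \<le> \<rho>" "\<mu> \<rho> = v" by auto
qed

lemma trunc_eq_scaleR:
  assumes "0 < \<rho>"
  shows "trunc \<rho> x = (\<rho> / max \<rho> (norm x)) *\<^sub>R x"
  using assms by (cases "x = 0"; cases "norm x \<le> \<rho>")
    (auto simp: trunc_def sgn_div_norm max_def min_def divide_inverse)

lemma norm_trunc: "0 < \<rho> \<Longrightarrow> norm (trunc \<rho> x) = min (norm x) \<rho>"
  by (cases "x = 0") (auto simp: trunc_def norm_sgn)

lemma trunc_inside: "norm x \<le> \<rho> \<Longrightarrow> trunc \<rho> x = x"
  by (cases "x = 0") (simp_all add: trunc_def min_def sgn_div_norm)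

lemma trunc_outside:
  assumes "0 < \<rho>" "\<rho> \<le> norm x"
  shows "x = (norm x / \<rho>) *\<^sub>R trunc \<rho> x"
  using assms by (auto simp: trunc_eq_scaleR max_def)

lemma norm_diff_trunc_le:
  assumes "0 < \<rho>"
  shows "norm (x - trunc \<rho> x) \<le> norm x"
proof -
  have "x - trunc \<rho> x = (1 - \<rho> / max \<rho> (norm x)) *\<^sub>R x"
    using assms by (simp add: trunc_eq_scaleR algebra_simps)
  moreover have "\<bar>1 - \<rho> / max \<rho> (norm x)\<bar> \<le> 1"
    using assms by (simp add: abs_if field_simps)
  ultimately show ?thesis
    by (metis mult_left_le_one_le norm_ge_zero norm_scaleR abs_ge_zero)
qed

lemma continuous_on_trunc [continuous_intros]:
  assumes "0 < \<rho>" "continuous_on S f"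
  shows "continuous_on S (\<lambda>x. trunc \<rho> (f x))"
  unfolding trunc_eq_scaleR[OF assms(1)] using assms
  by (intro continuous_intros) (auto simp: max_def)

lemma continuous_on_of_locally_lipschitz:
  fixes H :: "'b::real_normed_vector \<Rightarrow> 'b \<Rightarrow> 'c::real_normed_vector"
  assumes lip: "\<And>R x1 x2 y1 y2. \<lbrakk>0 < R; norm x1 \<le> R; norm x2 \<le> R; norm y1 \<le> R; norm y2 \<le> R\<rbrakk> \<Longrightarrow>
    (norm (H x1 y1 - H x2 y2))\<^sup>2 \<le> K R * ((norm (x1 - x2))\<^sup>2 + (norm (y1 - y2))\<^sup>2)"
  shows "continuous_on UNIV (\<lambda>p. H (fst p) (snd p))"
proof -
  have "isCont (\<lambda>p. H (fst p) (snd p)) q" for q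
  proof -
    let ?R = "norm q + 1"
    let ?u = "\<lambda>p. sqrt (K ?R * ((norm (fst p - fst q))\<^sup>2 + (norm (snd p - snd q))\<^sup>2))"
    have "((\<lambda>p. fst p - fst q) \<longlongrightarrow> 0) (at q)" "((\<lambda>p. snd p - snd q) \<longlongrightarrow> 0) (at q)"
      by (auto intro!: tendsto_eq_intros)
    then have u: "(?u \<longlongrightarrow> 0) (at q)"
      by (auto intro!: tendsto_eq_intros)
    have "eventually (\<lambda>p. dist p q < 1) (at q)"
      by (auto simp: eventually_at intro: exI[of _ 1])
    then have "eventually (\<lambda>p. norm (H (fst p) (snd p) - H (fst q) (snd q)) \<le> ?u p) (at q)"
    proof eventually_elim
      case (elim p)
      have "norm p \<le> ?R" using elim norm_triangle_ineq2[of p q] by (simp add: dist_norm)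
      moreover have "norm (fst q) \<le> norm q" "norm (snd q) \<le> norm q"
        "norm (fst p) \<le> norm p" "norm (snd p) \<le> norm p"
        by (metis norm_fst_le norm_snd_le prod.collapse)+
      ultimately have "norm (fst q) \<le> ?R" "norm (snd q) \<le> ?R" "norm (fst p) \<le> ?R" "norm (snd p) \<le> ?R"
        by linarith+
      moreover have "0 < ?R" by (simp add: add_nonneg_pos)
      ultimately show ?case by (intro real_le_rsqrt lip) auto
    qed
    with u have "((\<lambda>p. H (fst p) (snd p) - H (fst q) (snd q)) \<longlongrightarrow> 0) (at q)"
      by (rule Lim_null_comparison[rotated])
    then show ?thesis by (simp add: isCont_def LIM_zero_iff)
  qed
  then show ?thesis by (simp add: continuous_on_eq_continuous_at)
qed

lemma continuous_partial_trunc: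
  fixes H\<^sub>1 H :: "real ^ 'd \<Rightarrow> real ^ 'd \<Rightarrow> 'c::real_normed_vector"
  assumes "0 < \<rho>" and "continuous_on UNIV (\<lambda>p. H\<^sub>1 (fst p) (snd p))"
    and H: "continuous_on UNIV (\<lambda>p. H (fst p) (snd p))"
  shows "continuous_on UNIV (\<lambda>p. partial_trunc H\<^sub>1 H \<rho> (fst p) (snd p))"
proof -
  have "continuous_on UNIV (\<lambda>p. H (fst (trunc \<rho> (fst p), trunc \<rho> (snd p)))
      (snd (trunc \<rho> (fst p), trunc \<rho> (snd p))))"
    using assms(1) by (intro continuous_on_compose2[OF H] continuous_intros) auto
  with assms(2) show ?thesis
    unfolding partial_trunc_def by (auto intro: continuous_on_add)
qed

lemma square_add_le: "(a + b)\<^sup>2 \<le> 2 * a\<^sup>2 + 2 * (b::real)\<^sup>2"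
  using sum_squares_bound[of a b] by (simp add: power2_sum)

lemma norm_add_square_le:
  fixes u v :: "'c::real_normed_vector"
  shows "(norm (u + v))\<^sup>2 \<le> 2 * (norm u)\<^sup>2 + 2 * (norm v)\<^sup>2"
  by (rule order_trans[OF power_mono[OF norm_triangle_ineq[of u v]] square_add_le]) simp

lemma partial_trunc_linear_growth:
  fixes H\<^sub>1 H :: "real ^ 'd \<Rightarrow> real ^ 'd \<Rightarrow> 'c::real_normed_vector"
  assumes "0 < \<rho>" "0 \<le> K"
    and H1: "\<And>x y. (norm (H\<^sub>1 x y))\<^sup>2 \<le> L * ((norm x)\<^sup>2 + (norm y)\<^sup>2)"
    and H: "\<And>x y. \<lbrakk>norm x \<le> \<rho>; norm y \<le> \<rho>\<rbrakk> \<Longrightarrow> (norm (H x y))\<^sup>2 \<le> K * ((norm x)\<^sup>2 + (norm y)\<^sup>2)"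
  shows "(norm (partial_trunc H\<^sub>1 H \<rho> x y))\<^sup>2 \<le> 2 * (L + K) * ((norm x)\<^sup>2 + (norm y)\<^sup>2)"
proof -
  let ?x = "trunc \<rho> x" and ?y = "trunc \<rho> y"
  have "(norm (H ?x ?y))\<^sup>2 \<le> K * ((norm ?x)\<^sup>2 + (norm ?y)\<^sup>2)"
    using assms(1) by (intro H) (auto simp: norm_trunc)
  also have "\<dots> \<le> K * ((norm x)\<^sup>2 + (norm y)\<^sup>2)"
    using assms(1,2) by (intro mult_left_mono add_mono power_mono) (auto simp: norm_trunc)
  finally show ?thesis
    using norm_add_square_le[of "H\<^sub>1 x y" "H ?x ?y"] H1[of x y]
    unfolding partial_trunc_def by (simp add: algebra_simps)
qed

lemma lipschitz_const_nonneg: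
  fixes H :: "real ^ 'd \<Rightarrow> 'c::real_normed_vector"
  assumes "\<And>x. norm x \<le> 1 \<Longrightarrow> (norm (H x - H 0))\<^sup>2 \<le> K * (norm x)\<^sup>2"
  shows "0 \<le> K"
proof -
  define x where "x = (axis undefined 1 :: real ^ 'd)"
  have x: "norm x = 1" by (simp add: x_def norm_axis_1)
  have "0 \<le> (norm (H x - H 0))\<^sup>2" by simp
  also have "\<dots> \<le> K" using assms[of x] x by simp
  finally show ?thesis .
qed

text \<open>At a unit vector, dissipation at rate \<open>lam\<close> forces a drift of norm at least \<open>lam / 2\<close>.\<close>

lemma dissipation_square_le_lipschitz:
  fixes F1 :: "real ^ 'd \<Rightarrow> real ^ 'd \<Rightarrow> real ^ 'd"
  assumes "0 \<le> lam" and "\<And>x. 2 * (x \<bullet> F1 x 0) \<le> - lam * (norm x)\<^sup>2"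
    and "\<And>x. (norm (F1 x 0))\<^sup>2 \<le> L * (norm x)\<^sup>2"
  shows "lam\<^sup>2 \<le> 4 * L"
proof -
  define x where "x = (axis undefined 1 :: real ^ 'd)"
  have x: "norm x = 1" by (simp add: x_def norm_axis_1)
  have "\<bar>x \<bullet> F1 x 0\<bar> \<le> norm (F1 x 0)"
    using Cauchy_Schwarz_ineq2[of x "F1 x 0"] x by simp
  then have "lam \<le> 2 * norm (F1 x 0)" using assms(2)[of x] x by simp
  then have "lam\<^sup>2 \<le> (2 * norm (F1 x 0))\<^sup>2" using assms(1) by (intro power_mono)
  also have "\<dots> \<le> 4 * L" using assms(3)[of x] x by (simp add: power_mult_distrib)
  finally show ?thesis .
qed

text \<open>Near the origin the Lipschitz constants give the bound directly. Away from it the truncated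
  drift splits into the full drift at the truncated point, which is controlled by \<open>p\<close>, and an
  increment of the Lipschitz part. The weights \<open>8/3\<close> and \<open>8/5\<close> in Young's inequality are chosen
  such that the factor \<open>5\<close> from \<open>(1 + |x| + |y|)\<^sup>2\<close> becomes \<open>8\<close>.\<close>

lemma partial_trunc_drift_bound:
  fixes F1 F :: "real ^ 'd \<Rightarrow> real ^ 'd \<Rightarrow> real ^ 'd"
  assumes \<rho>: "1 \<le> \<rho>" and "0 \<le> L" "0 \<le> K" "0 \<le> p"
    and F1_zero: "F1 0 0 = 0"
    and F1: "\<And>x1 x2 y1 y2. (norm (F1 x1 y1 - F1 x2 y2))\<^sup>2
      \<le> L * ((norm (x1 - x2))\<^sup>2 + (norm (y1 - y2))\<^sup>2)"
    and F: "\<And>x y. \<lbrakk>norm x \<le> 1; norm y \<le> 1\<rbrakk> \<Longrightarrow> (norm (F x y))\<^sup>2 \<le> K * ((norm x)\<^sup>2 + (norm y)\<^sup>2)"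
    and growth: "\<And>x y. \<lbrakk>norm x \<le> \<rho>; norm y \<le> \<rho>\<rbrakk> \<Longrightarrow>
      norm (F1 x y + F x y) \<le> p * (1 + norm x + norm y)"
  shows "(norm (partial_trunc F1 F \<rho> x y))\<^sup>2
    \<le> (4 * L + 2 * K + 8 * p\<^sup>2) * ((norm x)\<^sup>2 + (norm y)\<^sup>2)"
proof -
  let ?x = "trunc \<rho> x" and ?y = "trunc \<rho> y" and ?n = "(norm x)\<^sup>2 + (norm y)\<^sup>2"
  have \<rho>0: "0 < \<rho>" using \<rho> by simp
  have n: "0 \<le> ?n" by simp
  show ?thesis
  proof (cases "norm x \<le> 1 \<and> norm y \<le> 1")
    case True
    then have "partial_trunc F1 F \<rho> x y = F1 x y + F x y"
      using \<rho> by (simp add: partial_trunc_def trunc_inside)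
    then have "(norm (partial_trunc F1 F \<rho> x y))\<^sup>2 \<le> 2 * (L * ?n) + 2 * (K * ?n)"
      using norm_add_square_le[of "F1 x y" "F x y"] F1[of x y 0 0] F[of x y] F1_zero True
      by auto
    also have "\<dots> \<le> (4 * L + 2 * K + 8 * p\<^sup>2) * ?n"
      using mult_right_mono[OF _ n, of "2 * L + 2 * K" "4 * L + 2 * K + 8 * p\<^sup>2"] assms
      by (simp add: algebra_simps)
    finally show ?thesis .
  next
    case False
    let ?u = "F1 x y - F1 ?x ?y" and ?v = "F1 ?x ?y + F ?x ?y"
    have "(norm ?u)\<^sup>2 \<le> L * ((norm (x - ?x))\<^sup>2 + (norm (y - ?y))\<^sup>2)" by (rule F1)
    also have "\<dots> \<le> L * ?n"
      using \<open>0 \<le> L\<close> \<rho>0 by (intro mult_left_mono add_mono power_mono norm_diff_trunc_le) auto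
    finally have u: "(norm ?u)\<^sup>2 \<le> L * ?n" .
    have "norm ?v \<le> p * (1 + norm ?x + norm ?y)"
      using \<rho>0 by (intro growth) (auto simp: norm_trunc)
    also have "\<dots> \<le> p * (1 + norm x + norm y)"
      using \<open>0 \<le> p\<close> \<rho>0 by (intro mult_left_mono) (auto simp: norm_trunc)
    finally have "(norm ?v)\<^sup>2 \<le> (p * (1 + norm x + norm y))\<^sup>2" by (rule power_mono) simp
    also have "\<dots> \<le> p\<^sup>2 * (5 * ?n)"
    proof -
      have *: "(1 + a + b)\<^sup>2 \<le> 5 * (a\<^sup>2 + b\<^sup>2)" if "1 < a" "0 \<le> b" for a b :: real
      proof -
        have "(1 + a + b)\<^sup>2 \<le> (2 * a + b)\<^sup>2" using that by (intro power_mono) auto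
        also have "\<dots> = 5 * (a\<^sup>2 + b\<^sup>2) - (a - 2 * b)\<^sup>2" by (simp add: power2_eq_square algebra_simps)
        also have "\<dots> \<le> 5 * (a\<^sup>2 + b\<^sup>2)" by simp
        finally show ?thesis .
      qed
      have "(1 + norm x + norm y)\<^sup>2 \<le> 5 * ?n"
      proof (cases "1 < norm x")
        case True
        then show ?thesis by (rule *) simp
      next
        case F': False
        with False have "1 < norm y" by simp
        from *[OF this, of "norm x"] show ?thesis by (simp add: ac_simps)
      qed
      then show ?thesis unfolding power_mult_distrib by (intro mult_left_mono) auto
    qed
    finally have v: "(norm ?v)\<^sup>2 \<le> 5 * p\<^sup>2 * ?n" by (simp only: mult.assoc mult.left_commute)
    have young: "(a + b)\<^sup>2 \<le> 8 / 3 * a\<^sup>2 + 8 / 5 * b\<^sup>2" for a b :: real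
    proof -
      have "8 / 3 * a\<^sup>2 + 8 / 5 * b\<^sup>2 - (a + b)\<^sup>2 = (5 * a - 3 * b)\<^sup>2 / 15"
        by (simp add: power2_eq_square field_simps)
      moreover have "0 \<le> (5 * a - 3 * b)\<^sup>2 / 15" by simp
      ultimately show ?thesis by linarith
    qed
    have "partial_trunc F1 F \<rho> x y = ?u + ?v" by (simp add: partial_trunc_def)
    then have "(norm (partial_trunc F1 F \<rho> x y))\<^sup>2 \<le> (norm ?u + norm ?v)\<^sup>2"
      using norm_triangle_ineq[of ?u ?v] by (simp add: power_mono del: add_diff_eq diff_add_eq)
    also have "\<dots> \<le> 8 / 3 * (norm ?u)\<^sup>2 + 8 / 5 * (norm ?v)\<^sup>2" by (rule young)
    also have "\<dots> \<le> 8 / 3 * (L * ?n) + 8 / 5 * (5 * p\<^sup>2 * ?n)" using u v by linarith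
    also have "\<dots> = (8 / 3 * L + 8 * p\<^sup>2) * ?n" by (simp add: algebra_simps)
    also have "\<dots> \<le> (4 * L + 2 * K + 8 * p\<^sup>2) * ?n"
      using assms n by (intro mult_right_mono) auto
    finally show ?thesis .
  qed
qed

text \<open>The extended-real weights \<open>1 + \<theta>\<close> and \<open>1 + \<theta>\<inverse>\<close> are conjugate in Young's inequality for
  \<open>|G\<^sub>1 + G|\<^sup>2\<close>. At \<open>\<theta> = 0\<close> and \<open>\<theta> = \<infinity>\<close> one of the two diffusion parts vanishes, and then
  both weights may be taken to be \<open>1\<close>.\<close>

lemma growth_bound_real_weights:
  fixes F1 F :: "real ^ 'd \<Rightarrow> real ^ 'd \<Rightarrow> real ^ 'd"
    and G1 G :: "real ^ 'd \<Rightarrow> real ^ 'd \<Rightarrow> real ^ 'm ^ 'd"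
  assumes "0 \<le> \<theta>"
    and V1: "growth_bound (1 + \<theta>) F1 G1 V\<^sub>1" and V: "growth_bound (1 + inverse \<theta>) F G V"
  obtains c1 c2 :: real where "0 \<le> c1" "0 \<le> c2"
    and "\<And>x y. 2 * (x \<bullet> F1 x y) + c1 * (norm (G1 x y))\<^sup>2 \<le> V\<^sub>1 x y"
    and "\<And>x y. 2 * (x \<bullet> F x y) + c2 * (norm (G x y))\<^sup>2 \<le> V x y"
    and "\<And>x y u v. (norm (G1 x y + G u v))\<^sup>2 \<le> c1 * (norm (G1 x y))\<^sup>2 + c2 * (norm (G u v))\<^sup>2"
proof -
  have vanish: "b x y = 0"
    if "growth_bound \<infinity> a b W" for a and b :: "real ^ 'd \<Rightarrow> real ^ 'd \<Rightarrow> real ^ 'm ^ 'd" and W x y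
  proof (rule ccontr)
    assume "b x y \<noteq> 0"
    then have "(\<infinity>::ereal) * ereal ((norm (b x y))\<^sup>2) = \<infinity>" by simp
    moreover have "ereal (2 * (x \<bullet> a x y)) + \<infinity> * ereal ((norm (b x y))\<^sup>2) \<le> ereal (W x y)"
      using that unfolding growth_bound_def by blast
    ultimately show False by simp
  qed
  have real: "2 * (x \<bullet> a x y) + c * (norm (b x y))\<^sup>2 \<le> W x y"
    if "growth_bound (ereal c) a b W" for c a W x y and b :: "real ^ 'd \<Rightarrow> real ^ 'd \<Rightarrow> real ^ 'm ^ 'd"
  proof -
    have "ereal (2 * (x \<bullet> a x y)) + ereal c * ereal ((norm (b x y))\<^sup>2) \<le> ereal (W x y)"
      using that unfolding growth_bound_def by blast
    then show ?thesis by simp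
  qed
  consider "\<theta> = 0" | "\<theta> = \<infinity>" | t where "\<theta> = ereal t" "0 < t"
    using \<open>0 \<le> \<theta>\<close> by (cases \<theta>) (auto simp: less_le)
  then show thesis
  proof cases
    case 1
    then have "growth_bound (ereal 1) F1 G1 V\<^sub>1" using V1 by (simp add: one_ereal_def)
    moreover have "growth_bound \<infinity> F G V" using V 1 by (simp add: one_ereal_def)
    moreover from vanish[OF this] have G: "G x y = 0" for x y .
    ultimately have "growth_bound (ereal 1) F G V"
      unfolding growth_bound_def by (simp add: zero_ereal_def[symmetric])
    with G \<open>growth_bound (ereal 1) F1 G1 V\<^sub>1\<close> show thesis
      by (intro that[of 1 1]) (auto dest: real simp del: mult_1)
  next
    case 2
    then have "growth_bound (ereal 1) F G V" using V by (simp add: one_ereal_def)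
    moreover have "growth_bound \<infinity> F1 G1 V\<^sub>1" using V1 2 by (simp add: one_ereal_def)
    moreover from vanish[OF this] have G: "G1 x y = 0" for x y .
    ultimately have "growth_bound (ereal 1) F1 G1 V\<^sub>1"
      unfolding growth_bound_def by (simp add: zero_ereal_def[symmetric])
    with G \<open>growth_bound (ereal 1) F G V\<close> show thesis
      by (intro that[of 1 1]) (auto dest: real simp del: mult_1)
  next
    case (3 t)
    have "1 + \<theta> = ereal (1 + t)" "1 + inverse \<theta> = ereal (1 + inverse t)"
      using 3 by (simp_all add: one_ereal_def)
    then have "growth_bound (ereal (1 + t)) F1 G1 V\<^sub>1" "growth_bound (ereal (1 + inverse t)) F G V"
      using V1 V by simp_all
    moreover have "(norm (u + v))\<^sup>2 \<le> (1 + t) * (norm u)\<^sup>2 + (1 + inverse t) * (norm v)\<^sup>2"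
      for u v :: "real ^ 'm ^ 'd"
    proof -
      have "(norm (u + v))\<^sup>2 \<le> (norm u + norm v)\<^sup>2" by (intro power_mono norm_triangle_ineq) simp
      also have "\<dots> = (1 + t) * (norm u)\<^sup>2 + (1 + inverse t) * (norm v)\<^sup>2
          - (t * norm u - norm v)\<^sup>2 / t"
        using 3 by (simp add: power2_eq_square field_simps)
      also have "\<dots> \<le> (1 + t) * (norm u)\<^sup>2 + (1 + inverse t) * (norm v)\<^sup>2" using 3 by simp
      finally show ?thesis .
    qed
    ultimately show thesis
      using 3 by (intro that[of "1 + t" "1 + inverse t"]) (auto dest: real)
  qed
qed

section \<open>Adding independent noise\<close>

lemma (in prob_space) indep_product_has_integral:
  fixes U :: "'a \<Rightarrow> real" and p :: "'b::topological_space \<Rightarrow> real"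
  assumes sub: "subalgebra M A"
    and indep: "indep_set (sets A) (sets (vimage_algebra (space M) Z borel))"
    and Z: "Z \<in> borel_measurable M" and U: "U \<in> borel_measurable A"
    and p: "p \<in> borel_measurable borel"
    and int: "integrable M U" "integrable M (\<lambda>\<omega>. p (Z \<omega>))"
  shows "has_bochner_integral M (\<lambda>\<omega>. U \<omega> * p (Z \<omega>))
    (expectation U * expectation (\<lambda>\<omega>. p (Z \<omega>)))"
proof -
  let ?V = "vimage_algebra (space M) Z borel"
  have generated: "sigma_sets (space M) {X -` S \<inter> space M | S. S \<in> sets borel} \<subseteq> sets B"
    if "X \<in> borel_measurable B" "space B = space M" for X :: "'a \<Rightarrow> real" and B
    using that measurable_sets[OF that(1)] by (subst that(2)[symmetric]) (intro sets.sigma_sets_subset; auto)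
  have "(\<lambda>\<omega>. p (Z \<omega>)) \<in> borel_measurable ?V"
    by (rule measurable_compose[OF measurable_vimage_algebra1 p]) simp
  note gen_p = generated[OF this]
  have "indep_var borel U borel (\<lambda>\<omega>. p (Z \<omega>))"
    unfolding indep_var_eq
  proof (intro conjI)
    show "random_variable borel U" using sub U by (rule measurable_from_subalg)
    show "random_variable borel (\<lambda>\<omega>. p (Z \<omega>))" using Z p by (rule measurable_compose)
    show "indep_set (sigma_sets (space M) {U -` S \<inter> space M | S. S \<in> sets borel})
        (sigma_sets (space M) {(\<lambda>\<omega>. p (Z \<omega>)) -` S \<inter> space M | S. S \<in> sets borel})"
      unfolding indep_set_def
    proof (rule indep_sets_mono_sets[OF indep[unfolded indep_set_def]])
      fix i :: bool
      show "case_bool (sigma_sets (space M) {U -` S \<inter> space M | S. S \<in> sets borel})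
          (sigma_sets (space M) {(\<lambda>\<omega>. p (Z \<omega>)) -` S \<inter> space M | S. S \<in> sets borel}) i
        \<subseteq> case_bool (sets A) (sets ?V) i"
        using generated[OF U] gen_p sub by (cases i) (simp_all add: subalgebra_def)
    qed
  qed
  from indep_var_integrable[OF this int] indep_var_lebesgue_integral[OF this int]
  show ?thesis by (simp add: has_bochner_integral_iff)
qed

lemma (in prob_space) brownian_increment:
  fixes B :: "real \<Rightarrow> 'a \<Rightarrow> real ^ 'm"
  assumes filt: "usual_filtration M \<F>" and bm: "brownian_motion M \<F> B"
    and st: "0 \<le> s" "s < t"
  defines "Z \<equiv> \<lambda>\<omega>. B t \<omega> - B s \<omega>"
  shows "Z \<in> borel_measurable M"
    and "indep_set (sets (\<F> s)) (sets (vimage_algebra (space M) Z borel))"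
    and "integrable M (\<lambda>\<omega>. Z \<omega> $ j)" and "expectation (\<lambda>\<omega>. Z \<omega> $ j) = 0"
    and "integrable M (\<lambda>\<omega>. Z \<omega> $ j * Z \<omega> $ l)"
    and "expectation (\<lambda>\<omega>. Z \<omega> $ j * Z \<omega> $ l) = (if j = l then t - s else 0)"
proof -
  have sub: "subalgebra M (\<F> r)" if "0 \<le> r" for r
    using filt that by (simp add: usual_filtration_def)
  have "B r \<in> borel_measurable M" if "0 \<le> r" for r
    using bm that by (intro measurable_from_subalg[OF sub]) (auto simp: brownian_motion_def)
  then show "Z \<in> borel_measurable M" unfolding Z_def using st by simp
  show "indep_set (sets (\<F> s)) (sets (vimage_algebra (space M) Z borel))"
    using bm st unfolding Z_def brownian_motion_def by blast
  have indep: "indep_vars (\<lambda>_. borel) (\<lambda>i \<omega>. Z \<omega> $ i) UNIV"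
    using bm st unfolding Z_def brownian_motion_def by blast
  let ?\<sigma> = "sqrt (t - s)"
  have \<sigma>: "0 < ?\<sigma>" using st by simp
  have D: "distributed M lborel (\<lambda>\<omega>. Z \<omega> $ i) (normal_density 0 ?\<sigma>)" for i
    using bm st unfolding Z_def brownian_motion_def by blast
  have int_power: "integrable M (\<lambda>\<omega>. (Z \<omega> $ i) ^ k)" for i k
    using integrable_normal_moment[OF \<sigma>, of 0 k] distributed_integrable[OF D[of i], of "\<lambda>x. x ^ k"]
    by simp
  have int1: "integrable M (\<lambda>\<omega>. Z \<omega> $ i)" for i
    using int_power[of i 1] by simp
  have mean: "expectation (\<lambda>\<omega>. Z \<omega> $ i) = 0" for i
    using normal_distributed_expectation[OF \<sigma> D[of i]] .
  show "integrable M (\<lambda>\<omega>. Z \<omega> $ j)" "expectation (\<lambda>\<omega>. Z \<omega> $ j) = 0" by (rule int1, rule mean)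
  have "integrable M (\<lambda>\<omega>. Z \<omega> $ j * Z \<omega> $ l) \<and>
    expectation (\<lambda>\<omega>. Z \<omega> $ j * Z \<omega> $ l) = (if j = l then t - s else 0)"
  proof (cases "j = l")
    case True
    have "variance (\<lambda>\<omega>. Z \<omega> $ l) = t - s"
      using normal_distributed_variance[OF \<sigma> D[of l]] st by simp
    then show ?thesis
      using True int_power[of l 2] mean[of l] by (simp add: power2_eq_square)
  next
    case False
    then have "(\<Prod>i\<in>{j, l}. Z \<omega> $ i) = Z \<omega> $ j * Z \<omega> $ l" for \<omega> by simp
    moreover have indep': "indep_vars (\<lambda>_. borel) (\<lambda>i \<omega>. Z \<omega> $ i) {j, l}"
      using indep by (rule indep_vars_subset) simp
    ultimately show ?thesis
      using indep_vars_integrable[OF _ indep' int1] indep_vars_lebesgue_integral[OF _ indep' int1]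
        False mean by simp
  qed
  then show "integrable M (\<lambda>\<omega>. Z \<omega> $ j * Z \<omega> $ l)"
    and "expectation (\<lambda>\<omega>. Z \<omega> $ j * Z \<omega> $ l) = (if j = l then t - s else 0)" by auto
qed

lemma norm_vec_square: "(norm (x :: real ^ 'n))\<^sup>2 = (\<Sum>i\<in>UNIV. (x $ i)\<^sup>2)"
  unfolding power2_norm_eq_inner inner_vec_def by (simp add: power2_eq_square)

lemma norm_matrix_square: "(norm (A :: real ^ 'm ^ 'n))\<^sup>2 = (\<Sum>i\<in>UNIV. \<Sum>j\<in>UNIV. (A $ i $ j)\<^sup>2)"
  unfolding power2_norm_eq_inner inner_vec_def by (simp add: power2_eq_square)

lemma norm_add_matrix_vector_square:
  fixes x :: "real ^ 'd" and A :: "real ^ 'm ^ 'd"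
  shows "(norm (x + A *v z))\<^sup>2 = (norm x)\<^sup>2 + ((\<Sum>i\<in>UNIV. \<Sum>j\<in>UNIV. (2 * (x $ i * A $ i $ j)) * z $ j)
    + (\<Sum>i\<in>UNIV. \<Sum>j\<in>UNIV. \<Sum>l\<in>UNIV. (A $ i $ j * A $ i $ l) * (z $ j * z $ l)))"
proof -
  have row: "(x $ i + (A *v z) $ i)\<^sup>2 = (x $ i)\<^sup>2 + ((\<Sum>j\<in>UNIV. (2 * (x $ i * A $ i $ j)) * z $ j)
    + (\<Sum>j\<in>UNIV. \<Sum>l\<in>UNIV. (A $ i $ j * A $ i $ l) * (z $ j * z $ l)))" for i
  proof -
    have "(\<Sum>j\<in>UNIV. A $ i $ j * z $ j)\<^sup>2
        = (\<Sum>j\<in>UNIV. \<Sum>l\<in>UNIV. (A $ i $ j * A $ i $ l) * (z $ j * z $ l))"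
      by (simp add: power2_eq_square sum_product ac_simps)
    moreover have "2 * x $ i * (\<Sum>j\<in>UNIV. A $ i $ j * z $ j) = (\<Sum>j\<in>UNIV. (2 * (x $ i * A $ i $ j)) * z $ j)"
      by (simp add: sum_distrib_left ac_simps)
    ultimately show ?thesis
      by (simp add: matrix_vector_mult_def power2_sum)
  qed
  show ?thesis by (simp add: norm_vec_square row sum.distrib)
qed

lemma integrable_mult_of_square_integrable:
  fixes u v :: "'a \<Rightarrow> real" and x :: "'a \<Rightarrow> 'b::real_normed_vector" and y :: "'a \<Rightarrow> 'c::real_normed_vector"
  assumes "u \<in> borel_measurable M" "v \<in> borel_measurable M"
    and "\<And>\<omega>. \<bar>u \<omega>\<bar> \<le> norm (x \<omega>)" "\<And>\<omega>. \<bar>v \<omega>\<bar> \<le> norm (y \<omega>)"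
    and "integrable M (\<lambda>\<omega>. (norm (x \<omega>))\<^sup>2)" "integrable M (\<lambda>\<omega>. (norm (y \<omega>))\<^sup>2)"
  shows "integrable M (\<lambda>\<omega>. u \<omega> * v \<omega>)"
proof (rule Bochner_Integration.integrable_bound)
  show "integrable M (\<lambda>\<omega>. (norm (x \<omega>))\<^sup>2 + (norm (y \<omega>))\<^sup>2)" using assms by simp
  show "AE \<omega> in M. norm (u \<omega> * v \<omega>) \<le> norm ((norm (x \<omega>))\<^sup>2 + (norm (y \<omega>))\<^sup>2)"
  proof (rule AE_I2)
    fix \<omega>
    have "\<bar>u \<omega> * v \<omega>\<bar> \<le> norm (x \<omega>) * norm (y \<omega>)"
      unfolding abs_mult using assms(3,4) by (intro mult_mono) auto
    also have "\<dots> \<le> (norm (x \<omega>))\<^sup>2 + (norm (y \<omega>))\<^sup>2"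
      using sum_squares_bound[of "norm (x \<omega>)" "norm (y \<omega>)"]
        mult_nonneg_nonneg[OF norm_ge_zero[of "x \<omega>"] norm_ge_zero[of "y \<omega>"]]
      by linarith
    finally show "norm (u \<omega> * v \<omega>) \<le> norm ((norm (x \<omega>))\<^sup>2 + (norm (y \<omega>))\<^sup>2)" by simp
  qed
qed (use assms in simp)

text \<open>The discrete Ito isometry: the noise is independent of the past and centred, so the mixed
  term has mean zero, and its covariance matrix is \<open>v\<close> times the identity.\<close>

lemma (in prob_space) second_moment_add_noise:
  fixes a :: "'a \<Rightarrow> real ^ 'd" and s :: "'a \<Rightarrow> real ^ 'm ^ 'd" and Z :: "'a \<Rightarrow> real ^ 'm"
  assumes sub: "subalgebra M A" and Z: "Z \<in> borel_measurable M"
    and indep: "indep_set (sets A) (sets (vimage_algebra (space M) Z borel))"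
    and Z1: "\<And>j. integrable M (\<lambda>\<omega>. Z \<omega> $ j)" "\<And>j. expectation (\<lambda>\<omega>. Z \<omega> $ j) = 0"
    and Z2: "\<And>j l. integrable M (\<lambda>\<omega>. Z \<omega> $ j * Z \<omega> $ l)"
      "\<And>j l. expectation (\<lambda>\<omega>. Z \<omega> $ j * Z \<omega> $ l) = (if j = l then v else 0)"
    and a[measurable]: "a \<in> borel_measurable A" and s[measurable]: "s \<in> borel_measurable A"
    and int_a: "integrable M (\<lambda>\<omega>. (norm (a \<omega>))\<^sup>2)" and int_s: "integrable M (\<lambda>\<omega>. (norm (s \<omega>))\<^sup>2)"
  shows "has_bochner_integral M (\<lambda>\<omega>. (norm (a \<omega> + s \<omega> *v Z \<omega>))\<^sup>2)
    (expectation (\<lambda>\<omega>. (norm (a \<omega>))\<^sup>2) + v * expectation (\<lambda>\<omega>. (norm (s \<omega>))\<^sup>2))"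
proof -
  have ai[measurable]: "(\<lambda>\<omega>. a \<omega> $ i) \<in> borel_measurable A" for i
    by (rule borel_measurable_continuous_on[OF _ a]) (intro continuous_intros)
  have sij[measurable]: "(\<lambda>\<omega>. s \<omega> $ i $ j) \<in> borel_measurable A" for i j
    by (rule borel_measurable_continuous_on[OF _ s]) (intro continuous_intros)
  have a_le: "\<bar>a \<omega> $ i\<bar> \<le> norm (a \<omega>)" for \<omega> i by (rule component_le_norm_cart)
  have s_le: "\<bar>s \<omega> $ i $ j\<bar> \<le> norm (s \<omega>)" for \<omega> i j
    using component_le_norm_cart[of "s \<omega> $ i" j] Finite_Cartesian_Product.norm_nth_le[of "s \<omega>" i] by linarith
  have lift: "u \<in> borel_measurable M" if "u \<in> borel_measurable A" for u :: "'a \<Rightarrow> real"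
    using sub that by (rule measurable_from_subalg)
  have int_as: "integrable M (\<lambda>\<omega>. a \<omega> $ i * s \<omega> $ i $ j)" for i j
    by (rule integrable_mult_of_square_integrable[OF lift[OF ai] lift[OF sij] a_le s_le int_a int_s])
  have int_ss: "integrable M (\<lambda>\<omega>. s \<omega> $ i $ j * s \<omega> $ i $ l)" for i j l
    by (rule integrable_mult_of_square_integrable[OF lift[OF sij] lift[OF sij] s_le s_le int_s int_s])
  have mixed: "has_bochner_integral M (\<lambda>\<omega>. (2 * (a \<omega> $ i * s \<omega> $ i $ j)) * Z \<omega> $ j) 0" for i j
    using indep_product_has_integral[OF sub indep Z, of "\<lambda>\<omega>. 2 * (a \<omega> $ i * s \<omega> $ i $ j)" "\<lambda>z. z $ j"]
      int_as[of i j] Z1 by simp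
  have quad: "has_bochner_integral M (\<lambda>\<omega>. (s \<omega> $ i $ j * s \<omega> $ i $ l) * (Z \<omega> $ j * Z \<omega> $ l))
      (if j = l then v * expectation (\<lambda>\<omega>. (s \<omega> $ i $ j)\<^sup>2) else 0)" for i j l
    using indep_product_has_integral[OF sub indep Z, of "\<lambda>\<omega>. s \<omega> $ i $ j * s \<omega> $ i $ l" "\<lambda>z. z $ j * z $ l"]
      int_ss[of i j l] Z2 by (auto simp: power2_eq_square mult.commute split: if_splits)
  have "has_bochner_integral M (\<lambda>\<omega>. (norm (a \<omega> + s \<omega> *v Z \<omega>))\<^sup>2)
    (expectation (\<lambda>\<omega>. (norm (a \<omega>))\<^sup>2) + ((\<Sum>i\<in>(UNIV::'d set). \<Sum>j\<in>(UNIV::'m set). 0)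
      + (\<Sum>i\<in>UNIV. \<Sum>j\<in>UNIV. \<Sum>l\<in>UNIV. if j = l then v * expectation (\<lambda>\<omega>. (s \<omega> $ i $ j)\<^sup>2) else 0)))"
    unfolding norm_add_matrix_vector_square
    by (intro has_bochner_integral_add has_bochner_integral_sum mixed quad
        has_bochner_integral_integrable int_a)
  moreover have "expectation (\<lambda>\<omega>. (norm (s \<omega>))\<^sup>2)
      = (\<Sum>i\<in>UNIV. \<Sum>j\<in>UNIV. expectation (\<lambda>\<omega>. (s \<omega> $ i $ j)\<^sup>2))"
    using int_ss unfolding norm_matrix_square
    by (simp add: Bochner_Integration.integral_sum Bochner_Integration.integrable_sum power2_eq_square)
  ultimately show ?thesis
    by (simp add: sum_distrib_left)
qed

section \<open>Decay of delayed recursions\<close>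

text \<open>Two indices with the same delayed index are close: between them the delay grows by almost
  their distance, whereas its slope is at most \<open>c < 1\<close>.\<close>

lemma delay_fibre_card_le:
  fixes \<delta> :: "real \<Rightarrow> real"
  assumes "0 < h" "0 \<le> c" "c < 1" and nonneg: "\<And>t. 0 \<le> t \<Longrightarrow> 0 \<le> \<delta> t"
    and lip: "\<And>s t. \<lbrakk>0 \<le> s; 0 \<le> t\<rbrakk> \<Longrightarrow> \<bar>\<delta> s - \<delta> t\<bar> \<le> c * \<bar>s - t\<bar>"
  shows "real (card {k. k < n \<and> int k - int (delay_steps \<delta> h (int k)) = j})
    \<le> of_int (\<lfloor>1 / (1 - c)\<rfloor> + 1)"
proof -
  let ?S = "{k. k < n \<and> int k - int (delay_steps \<delta> h (int k)) = j}" and ?m = "nat \<lfloor>1 / (1 - c)\<rfloor>"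
  have fl: "0 \<le> \<lfloor>1 / (1 - c)\<rfloor>" using assms by simp
  have steps: "int (delay_steps \<delta> h (int k)) = \<lfloor>\<delta> (real k * h) / h\<rfloor>" for k
    using nonneg[of "real k * h"] \<open>0 < h\<close> by (simp add: delay_steps_def)
  have near: "k \<le> i + ?m" if "i \<in> ?S" "k \<in> ?S" "i \<le> k" for i k
  proof -
    let ?x = "\<delta> (real k * h) / h" and ?y = "\<delta> (real i * h) / h"
    have "int k - int i = \<lfloor>?x\<rfloor> - \<lfloor>?y\<rfloor>" using that steps[of k] steps[of i] by auto
    then have "real k - real i = of_int \<lfloor>?x\<rfloor> - of_int \<lfloor>?y\<rfloor>"
      by (metis of_int_diff of_int_of_nat_eq)
    also have "\<dots> < ?x - ?y + 1" by linarith
    finally have 1: "real k - real i < ?x - ?y + 1" .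
    have "\<delta> (real k * h) - \<delta> (real i * h) \<le> c * \<bar>real k * h - real i * h\<bar>"
      using lip[of "real k * h" "real i * h"] \<open>0 < h\<close> by simp
    also have "\<bar>real k * h - real i * h\<bar> = (real k - real i) * h"
      using \<open>i \<le> k\<close> \<open>0 < h\<close> by (simp add: left_diff_distrib[symmetric] abs_mult)
    finally have "?x - ?y \<le> c * (real k - real i)"
      using \<open>0 < h\<close> by (simp add: diff_divide_distrib[symmetric] divide_le_eq ac_simps)
    with 1 have "(real k - real i) * (1 - c) < 1" by (simp add: algebra_simps)
    then have "real k - real i < 1 / (1 - c)" using \<open>c < 1\<close> by (simp add: pos_less_divide_eq)
    then have "of_int (int k - int i) \<le> 1 / (1 - c)" by simp
    then have "int k - int i \<le> \<lfloor>1 / (1 - c)\<rfloor>" by (simp only: le_floor_iff)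
    then show ?thesis using fl by linarith
  qed
  show ?thesis
  proof (cases "?S = {}")
    case True
    show ?thesis unfolding True using fl by simp
  next
    case False
    have fin: "finite ?S" by simp
    have "?S \<subseteq> {Min ?S..Min ?S + ?m}"
    proof
      fix k assume k: "k \<in> ?S"
      then have "Min ?S \<le> k" using fin by (rule Min_le[rotated])
      with near[OF Min_in[OF fin False] k] show "k \<in> {Min ?S..Min ?S + ?m}" by simp
    qed
    then have "card ?S \<le> ?m + 1"
      using card_mono[of "{Min ?S..Min ?S + ?m}" ?S] by simp
    then have "real (card ?S) \<le> real (?m + 1)" by (simp only: of_nat_le_iff)
    then show ?thesis using fl by simp
  qed
qed

lemma delayed_sum_le:
  fixes u :: "int \<Rightarrow> real" and d :: "nat \<Rightarrow> nat"
  assumes nonneg: "\<And>j. - int N \<le> j \<Longrightarrow> 0 \<le> u j" and d: "\<And>k. d k \<le> N"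
    and fibre: "\<And>j. real (card {k. k < n \<and> int k - int (d k) = j}) \<le> \<kappa>"
  shows "(\<Sum>k<n. u (int k - int (d k))) \<le> \<kappa> * (\<Sum>j\<in>{- int N..<0}. u j) + \<kappa> * (\<Sum>k<n. u (int k))"
proof -
  let ?g = "\<lambda>k. int k - int (d k)" and ?J = "{- int N..<int n}"
  have range: "?g ` {..<n} \<subseteq> ?J"
  proof
    fix j assume "j \<in> ?g ` {..<n}"
    then obtain k where "k < n" "j = ?g k" by auto
    with d[of k] show "j \<in> ?J" by auto
  qed
  have "(\<Sum>k<n. u (?g k)) = (\<Sum>j\<in>?J. \<Sum>k\<in>{k\<in>{..<n}. ?g k = j}. u (?g k))"
    using range by (intro sum.group[symmetric]) auto
  also have "\<dots> = (\<Sum>j\<in>?J. real (card {k. k < n \<and> ?g k = j}) * u j)"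
    by (intro sum.cong) simp_all
  also have "\<dots> \<le> (\<Sum>j\<in>?J. \<kappa> * u j)"
    using nonneg by (intro sum_mono mult_right_mono fibre) auto
  also have "\<dots> = \<kappa> * ((\<Sum>j\<in>{- int N..<0}. u j) + (\<Sum>j\<in>{0..<int n}. u j))"
  proof -
    have "?J = {- int N..<0} \<union> {0..<int n}" by auto
    then show ?thesis by (simp add: sum_distrib_left[symmetric] sum.union_disjoint)
  qed
  also have "(\<Sum>j\<in>{0..<int n}. u j) = (\<Sum>k<n. u (int k))"
    by (rule sum.reindex_bij_witness[of _ int nat]) auto
  finally show ?thesis by (simp add: algebra_simps)
qed

text \<open>A discrete Halanay inequality. As the delayed value enters through its worst case, each
  delayed index counts once, regardless of how often the delay hits it.\<close>

lemma halanay_decay: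
  fixes w :: "int \<Rightarrow> real" and d :: "nat \<Rightarrow> nat"
  assumes "0 < h" "0 \<le> \<gamma>" "0 \<le> c1" "0 \<le> c2" and \<tau>: "\<tau> = real N * h"
    and rate: "c1 + c2 * exp (\<gamma> * \<tau>) \<le> exp (- \<gamma> * h)"
    and nonneg: "\<And>j. 0 \<le> w j" and d: "\<And>k. d k \<le> N"
    and step: "\<And>k. w (int k + 1) \<le> c1 * w (int k) + c2 * w (int k - int (d k))"
  shows "\<exists>K>0. \<forall>k. w (int k) \<le> K * exp (- \<gamma> * (real k * h))"
proof -
  \<comment> \<open>\<open>K\<close> dominates the initial segment, where \<open>exp(- \<gamma> t) \<ge> 1\<close>.\<close>
  define K where "K = 1 + (\<Sum>j\<in>{- int N..0}. w j)"
  let ?e = "\<lambda>j. K * exp (- \<gamma> * (of_int j * h))"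
  have K: "0 < K" using nonneg by (auto simp: K_def intro!: add_pos_nonneg sum_nonneg)
  have "w j \<le> ?e j" if "- int N \<le> j" for j
    using that
  proof (induction "nat j" arbitrary: j rule: less_induct)
    case less
    show ?case
    proof (cases "j \<le> 0")
      case True
      have "w j \<le> K"
        using member_le_sum[of j "{- int N..0}" w] less.prems True nonneg by (auto simp: K_def)
      moreover have "0 \<le> - \<gamma> * (of_int j * h)"
        using True \<open>0 \<le> \<gamma>\<close> \<open>0 < h\<close> by (simp add: mult_nonneg_nonpos mult_nonpos_nonneg)
      then have "K * 1 \<le> ?e j" using K by (intro mult_left_mono) auto
      ultimately show ?thesis by simp
    next
      case False
      define k where "k = nat (j - 1)"
      have k: "j = int k + 1" using False by (simp add: k_def)
      have "w (int k) \<le> ?e (int k)" by (rule less.hyps) (use k in auto)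
      moreover have "w (int k - int (d k)) \<le> ?e (int k - int (d k))"
        by (rule less.hyps) (use k d[of k] in auto)
      moreover have "?e (int k - int (d k)) \<le> exp (\<gamma> * \<tau>) * ?e (int k)"
      proof -
        have "real (d k) * h \<le> real N * h" using d[of k] \<open>0 < h\<close> by simp
        then have "\<gamma> * (real (d k) * h) \<le> \<gamma> * (real N * h)"
          using \<open>0 \<le> \<gamma>\<close> by (intro mult_left_mono)
        then have "exp (- \<gamma> * (of_int (int k - int (d k)) * h)) \<le> exp (\<gamma> * \<tau> + - \<gamma> * (of_int (int k) * h))"
          by (simp add: \<tau> algebra_simps)
        then have "K * exp (- \<gamma> * (of_int (int k - int (d k)) * h))
            \<le> K * exp (\<gamma> * \<tau> + - \<gamma> * (of_int (int k) * h))"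
          using K by simp
        then show ?thesis by (simp only: exp_add mult.left_commute)
      qed
      ultimately have "c1 * w (int k) + c2 * w (int k - int (d k))
          \<le> c1 * ?e (int k) + c2 * (exp (\<gamma> * \<tau>) * ?e (int k))"
        using assms(3,4) by (intro add_mono mult_left_mono) auto
      also have "\<dots> = (c1 + c2 * exp (\<gamma> * \<tau>)) * ?e (int k)" by (simp add: algebra_simps)
      also have "\<dots> \<le> exp (- \<gamma> * h) * ?e (int k)" using K by (intro mult_right_mono rate) simp
      also have "\<dots> = ?e j" unfolding k by (simp add: mult_exp_exp algebra_simps)
      finally show ?thesis using step[of k] k by simp
    qed
  qed
  from this[of "int _"] K show ?thesis by (intro exI[of _ K]) auto
qed

text \<open>Here \<open>v\<close> is only controlled in the sum: the negative terms at an index pay for all later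
  delayed terms that refer to it, of which there are at most \<open>\<kappa>\<close>.\<close>

lemma summed_decay:
  fixes w v :: "int \<Rightarrow> real" and d :: "nat \<Rightarrow> nat"
  assumes h: "0 < h" and "0 \<le> \<gamma>" "0 \<le> C" "0 \<le> b" "0 \<le> \<kappa>" and \<tau>: "\<tau> = real N * h"
    and rate: "\<kappa> * C * exp (\<gamma> * \<tau>) + (1 - exp (- \<gamma> * h)) / h \<le> A"
    and balance: "\<kappa> * b * exp (\<gamma> * \<tau>) \<le> a"
    and w: "\<And>j. 0 \<le> w j" and v: "\<And>j. 0 \<le> v j" and d: "\<And>k. d k \<le> N"
    and fibre: "\<And>n j. real (card {k. k < n \<and> int k - int (d k) = j}) \<le> \<kappa>"
    and step: "\<And>k. w (int k + 1) \<le> (1 - h * A) * w (int k) + h * C * w (int k - int (d k))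
      - h * a * v (int k) + h * b * v (int k - int (d k))"
  shows "\<exists>K>0. \<forall>k. w (int k) \<le> K * exp (- \<gamma> * (real k * h))"
proof -
  let ?\<tau> = "exp (\<gamma> * \<tau>)" and ?r = "(1 - exp (- \<gamma> * h)) / h"
  \<comment> \<open>The weight of the later endpoint, since the increment from \<open>j\<close> to \<open>j + 1\<close> is estimated there.\<close>
  define e where "e j = exp (\<gamma> * (of_int (j + 1) * h))" for j :: int
  define p where "p j = e j * w j" for j
  define q where "q j = e j * v j" for j
  have e_pos: "0 < e j" for j by (simp add: e_def)
  have p: "0 \<le> p j" and q: "0 \<le> q j" for j using e_pos[of j] w v by (auto simp: p_def q_def)
  have e_delay: "e (int k) \<le> ?\<tau> * e (int k - int (d k))" for k
  proof -
    have "real (d k) * h \<le> real N * h" using d[of k] h by simp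
    then have "\<gamma> * (real (d k) * h) \<le> \<gamma> * (real N * h)"
      using \<open>0 \<le> \<gamma>\<close> by (intro mult_left_mono)
    then show ?thesis by (simp add: e_def mult_exp_exp \<tau> algebra_simps)
  qed
  let ?W = "\<lambda>k::nat. exp (\<gamma> * (real k * h)) * w (int k)"
  have diff: "?W (Suc k) - ?W k \<le> - (h * (A - ?r)) * p (int k) + h * C * ?\<tau> * p (int k - int (d k))
      - h * a * q (int k) + h * b * ?\<tau> * q (int k - int (d k))" for k
  proof -
    let ?k = "int k" and ?i = "int k - int (d k)"
    have "?W (Suc k) = e ?k * w (?k + 1)" by (simp add: e_def add.commute)
    also have "\<dots> \<le> e ?k * ((1 - h * A) * w ?k + h * C * w ?i - h * a * v ?k + h * b * v ?i)"
      using e_pos[of ?k] by (intro mult_left_mono step) simp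
    also have "\<dots> = (1 - h * A) * p ?k + h * C * (e ?k * w ?i) - h * a * q ?k + h * b * (e ?k * v ?i)"
      by (simp add: p_def q_def algebra_simps)
    also have "\<dots> \<le> (1 - h * A) * p ?k + h * C * (?\<tau> * e ?i * w ?i) - h * a * q ?k
        + h * b * (?\<tau> * e ?i * v ?i)"
    proof -
      have "h * C * (e ?k * w ?i) \<le> h * C * (?\<tau> * e ?i * w ?i)"
        using h \<open>0 \<le> C\<close> w by (intro mult_left_mono mult_right_mono e_delay) auto
      moreover have "h * b * (e ?k * v ?i) \<le> h * b * (?\<tau> * e ?i * v ?i)"
        using h \<open>0 \<le> b\<close> v by (intro mult_left_mono mult_right_mono e_delay) auto
      ultimately show ?thesis by linarith
    qed
    also have "\<dots> = (1 - h * A) * p ?k + h * C * ?\<tau> * p ?i - h * a * q ?k + h * b * ?\<tau> * q ?i"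
      by (simp add: p_def q_def ac_simps)
    finally have "?W (Suc k) \<le> (1 - h * A) * p ?k + h * C * ?\<tau> * p ?i - h * a * q ?k + h * b * ?\<tau> * q ?i" .
    moreover have "exp (\<gamma> * (real k * h)) = exp (- \<gamma> * h) * e ?k"
      by (simp add: e_def mult_exp_exp algebra_simps)
    then have "?W k = (1 - h * ?r) * p ?k" using h by (simp add: p_def)
    ultimately show ?thesis by (simp add: algebra_simps)
  qed
  \<comment> \<open>What the delayed sums pick up from the initial segment is not compensated and goes into \<open>K\<close>.\<close>
  define K where "K = 1 + w 0 + h * C * ?\<tau> * (\<kappa> * (\<Sum>j\<in>{- int N..<0}. p j))
      + h * b * ?\<tau> * (\<kappa> * (\<Sum>j\<in>{- int N..<0}. q j))"
  have "0 \<le> (\<Sum>j\<in>{- int N..<0}. p j)" "0 \<le> (\<Sum>j\<in>{- int N..<0}. q j)"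
    using p q by (auto intro: sum_nonneg)
  then have K: "0 < K" using h assms(3-5) w[of 0] unfolding K_def
    by (intro add_pos_nonneg mult_nonneg_nonneg) auto
  have "?W n \<le> K" for n
  proof -
    have "?W n - ?W 0 = (\<Sum>k<n. ?W (Suc k) - ?W k)" by (rule sum_lessThan_telescope[symmetric])
    also have "\<dots> \<le> (\<Sum>k<n. - (h * (A - ?r)) * p (int k) + h * C * ?\<tau> * p (int k - int (d k))
      - h * a * q (int k) + h * b * ?\<tau> * q (int k - int (d k)))"
      by (intro sum_mono diff)
    also have "\<dots> = - (h * (A - ?r)) * (\<Sum>k<n. p (int k)) + h * C * ?\<tau> * (\<Sum>k<n. p (int k - int (d k)))
      - h * a * (\<Sum>k<n. q (int k)) + h * b * ?\<tau> * (\<Sum>k<n. q (int k - int (d k)))"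
      by (simp only: sum.distrib sum_subtractf sum_distrib_left)
    also have "\<dots> \<le> - (h * (A - ?r)) * (\<Sum>k<n. p (int k))
      + h * C * ?\<tau> * (\<kappa> * (\<Sum>j\<in>{- int N..<0}. p j) + \<kappa> * (\<Sum>k<n. p (int k)))
      - h * a * (\<Sum>k<n. q (int k))
      + h * b * ?\<tau> * (\<kappa> * (\<Sum>j\<in>{- int N..<0}. q j) + \<kappa> * (\<Sum>k<n. q (int k)))"
    proof -
      have "h * C * ?\<tau> * (\<Sum>k<n. p (int k - int (d k)))
          \<le> h * C * ?\<tau> * (\<kappa> * (\<Sum>j\<in>{- int N..<0}. p j) + \<kappa> * (\<Sum>k<n. p (int k)))"
        using h \<open>0 \<le> C\<close> by (intro mult_left_mono delayed_sum_le p d fibre) auto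
      moreover have "h * b * ?\<tau> * (\<Sum>k<n. q (int k - int (d k)))
          \<le> h * b * ?\<tau> * (\<kappa> * (\<Sum>j\<in>{- int N..<0}. q j) + \<kappa> * (\<Sum>k<n. q (int k)))"
        using h \<open>0 \<le> b\<close> by (intro mult_left_mono delayed_sum_le q d fibre) auto
      ultimately show ?thesis by linarith
    qed
    also have "\<dots> = (K - 1 - w 0) - h * (A - ?r - \<kappa> * C * ?\<tau>) * (\<Sum>k<n. p (int k))
        - h * (a - \<kappa> * b * ?\<tau>) * (\<Sum>k<n. q (int k))"
      unfolding K_def by (simp add: algebra_simps)
    also have "\<dots> \<le> K - 1 - w 0"
    proof -
      have "0 \<le> h * (A - ?r - \<kappa> * C * ?\<tau>) * (\<Sum>k<n. p (int k))"
        using h rate p by (intro mult_nonneg_nonneg sum_nonneg) auto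
      moreover have "0 \<le> h * (a - \<kappa> * b * ?\<tau>) * (\<Sum>k<n. q (int k))"
        using h balance q by (intro mult_nonneg_nonneg sum_nonneg) auto
      ultimately show ?thesis by linarith
    qed
    finally show ?thesis by simp
  qed
  then have "w (int n) \<le> K * exp (- \<gamma> * (real n * h))" for n
    by (simp add: exp_minus divide_inverse[symmetric] pos_le_divide_eq mult.commute)
  with K show ?thesis by auto
qed

lemma limsup_ln_le_of_exponential_bound:
  fixes m :: "nat \<Rightarrow> ennreal"
  assumes "0 < h" "0 < K" and m: "\<And>k. m k \<le> ennreal (K * exp (- \<gamma> * (real k * h)))"
  shows "limsup (\<lambda>k. ln_ennreal (m k) / ereal (real k * h)) \<le> ereal (- \<gamma>)"
proof -
  have ln_le: "ln_ennreal (m k) \<le> ereal (ln K - \<gamma> * (real k * h))" for k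
  proof (cases "m k = 0")
    case False
    have "m k \<noteq> \<infinity>" using m[of k] by (auto simp: top_unique)
    then obtain r where r: "m k = ennreal r" "0 \<le> r" by (cases "m k") auto
    with False have "0 < r" by (cases "r = 0") auto
    moreover have "r \<le> K * exp (- \<gamma> * (real k * h))"
      using m[of k] r \<open>0 < K\<close> by (simp add: ennreal_le_iff)
    ultimately have "ln r \<le> ln (K * exp (- \<gamma> * (real k * h)))" using \<open>0 < K\<close> by simp
    also have "\<dots> = ln K - \<gamma> * (real k * h)" using \<open>0 < K\<close> by (simp add: ln_mult)
    finally show ?thesis using r False by (simp add: ln_ennreal_def)
  qed (simp add: ln_ennreal_def)
  have "eventually (\<lambda>k. ln_ennreal (m k) / ereal (real k * h) \<le> ereal (ln K / (real k * h) - \<gamma>)) sequentially"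
    using eventually_gt_at_top[of 0]
  proof eventually_elim
    case (elim k)
    then have kh: "0 < real k * h" using \<open>0 < h\<close> by simp
    then have "ln_ennreal (m k) / ereal (real k * h) \<le> ereal (ln K - \<gamma> * (real k * h)) / ereal (real k * h)"
      by (intro ereal_divide_right_mono ln_le) auto
    also have "\<dots> = ereal (ln K / (real k * h) - \<gamma>)"
      using elim \<open>0 < h\<close> by (simp add: field_simps)
    finally show ?case .
  qed
  then have "limsup (\<lambda>k. ln_ennreal (m k) / ereal (real k * h))
      \<le> limsup (\<lambda>k. ereal (ln K / (real k * h) - \<gamma>))"
    by (rule Limsup_mono)
  also have "\<dots> = ereal (- \<gamma>)"
  proof (rule lim_imp_Limsup)
    have "filterlim (\<lambda>k. real k * h) at_top sequentially"
      unfolding mult.commute[of _ h] using \<open>0 < h\<close>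
      by (intro filterlim_tendsto_pos_mult_at_top[OF tendsto_const] filterlim_real_sequentially)
    then have "(\<lambda>k. ln K / (real k * h) - \<gamma>) \<longlonglongrightarrow> 0 - \<gamma>"
      by (intro tendsto_intros real_tendsto_divide_at_top[OF tendsto_const])
    then show "(\<lambda>k. ereal (ln K / (real k * h) - \<gamma>)) \<longlonglongrightarrow> ereal (- \<gamma>)" by simp
  qed simp
  finally show ?thesis .
qed

lemma step_function_integral_finite:
  fixes m :: "int \<Rightarrow> ennreal"
  assumes "0 < h" "0 < \<gamma>" "0 < K" and m: "\<And>k. m (int k) \<le> ennreal (K * exp (- \<gamma> * (real k * h)))"
  shows "(\<integral>\<^sup>+ s\<in>{0..}. m \<lfloor>s / h\<rfloor> \<partial>lborel) < \<infinity>"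
proof -
  let ?g = "\<lambda>s. K * exp (\<gamma> * h) * exp (- \<gamma> * s)"
  have "(\<integral>\<^sup>+ s\<in>{0..}. m \<lfloor>s / h\<rfloor> \<partial>lborel) \<le> (\<integral>\<^sup>+ s\<in>{0..}. ennreal (?g s) \<partial>lborel)"
  proof (rule nn_integral_mono)
    fix s :: real
    show "m \<lfloor>s / h\<rfloor> * indicator {0..} s \<le> ennreal (?g s) * indicator {0..} s"
    proof (cases "0 \<le> s")
      case True
      define k where "k = nat \<lfloor>s / h\<rfloor>"
      have k: "\<lfloor>s / h\<rfloor> = int k" using True \<open>0 < h\<close> by (simp add: k_def)
      then have "s / h < real k + 1" by linarith
      then have "s \<le> (real k + 1) * h" using \<open>0 < h\<close> by (simp add: pos_divide_less_eq)
      then have "\<gamma> * s \<le> \<gamma> * ((real k + 1) * h)" using \<open>0 < \<gamma>\<close> by (intro mult_left_mono) auto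
      then have "exp (- \<gamma> * (real k * h)) \<le> exp (\<gamma> * h) * exp (- \<gamma> * s)"
        by (simp add: mult_exp_exp algebra_simps)
      then have "K * exp (- \<gamma> * (real k * h)) \<le> ?g s"
        using \<open>0 < K\<close> by (simp add: mult.assoc)
      then have "ennreal (K * exp (- \<gamma> * (real k * h))) \<le> ennreal (?g s)" by (rule ennreal_leI)
      then have "m (int k) \<le> ennreal (?g s)" by (rule order_trans[OF m])
      with k True show ?thesis by simp
    qed simp
  qed
  also have "\<dots> = ennreal (0 - (- (K * exp (\<gamma> * h) / \<gamma>) * exp (- \<gamma> * 0)))"
  proof (rule nn_integral_FTC_atLeast)
    show "((\<lambda>s. - (K * exp (\<gamma> * h) / \<gamma>) * exp (- \<gamma> * s)) has_real_derivative ?g s) (at s)" for s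
      using \<open>0 < \<gamma>\<close> by (auto intro!: derivative_eq_intros)
    have "filterlim (\<lambda>s. - \<gamma> * s) at_bot at_top"
      using \<open>0 < \<gamma>\<close> by (intro filterlim_tendsto_neg_mult_at_bot[OF tendsto_const] filterlim_ident) auto
    then have "((\<lambda>s. exp (- \<gamma> * s)) \<longlongrightarrow> 0) at_top" by (rule filterlim_compose[OF exp_at_bot])
    then show "((\<lambda>s. - (K * exp (\<gamma> * h) / \<gamma>) * exp (- \<gamma> * s)) \<longlongrightarrow> 0) at_top"
      by (rule tendsto_mult_right_zero)
  qed (use \<open>0 < K\<close> in auto)
  also have "\<dots> < \<infinity>" by simp
  finally show ?thesis .
qed

section \<open>Second moments of the scheme\<close>

lemma borel_measurable_matrix_vector:
  fixes A :: "'a \<Rightarrow> real ^ 'm ^ 'd" and z :: "'a \<Rightarrow> real ^ 'm"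
  assumes "A \<in> borel_measurable M" "z \<in> borel_measurable M"
  shows "(\<lambda>\<omega>. A \<omega> *v z \<omega>) \<in> borel_measurable M"
  by (rule borel_measurable_continuous_Pair[OF assms])
    (unfold matrix_vector_mult_def, intro continuous_intros)

text \<open>The growth constant \<open>K\<close> keeps the second moment finite from one step to the next.\<close>

locale driven_scheme = prob_space M for M :: "'a measure" +
  fixes \<F> :: "real \<Rightarrow> 'a measure" and B :: "real \<Rightarrow> 'a \<Rightarrow> real ^ 'm"
    and a :: "real ^ 'd \<Rightarrow> real ^ 'd \<Rightarrow> real ^ 'd" and b :: "real ^ 'd \<Rightarrow> real ^ 'd \<Rightarrow> real ^ 'm ^ 'd"
    and \<delta> :: "real \<Rightarrow> real" and \<xi> :: "real \<Rightarrow> real ^ 'd" and h K :: real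
  assumes filtration: "usual_filtration M \<F>" and brownian: "brownian_motion M \<F> B"
    and h_pos: "0 < h"
    and cont_a: "continuous_on UNIV (\<lambda>p. a (fst p) (snd p))"
    and cont_b: "continuous_on UNIV (\<lambda>p. b (fst p) (snd p))"
    and growth_a: "(norm (a x y))\<^sup>2 \<le> K * ((norm x)\<^sup>2 + (norm y)\<^sup>2)"
    and growth_b: "(norm (b x y))\<^sup>2 \<le> K * ((norm x)\<^sup>2 + (norm y)\<^sup>2)"
begin

definition Y :: "int \<Rightarrow> 'a \<Rightarrow> real ^ 'd" where
  "Y k \<omega> = em_scheme a b \<delta> \<xi> h (\<lambda>t. B t \<omega>) k"

definition prev :: "int \<Rightarrow> int" where
  "prev k = k - int (delay_steps \<delta> h k)"

lemma prev_le: "prev k \<le> k"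
  by (simp add: prev_def)

lemma Y_initial: "k \<le> 0 \<Longrightarrow> Y k \<omega> = \<xi> (of_int k * h)"
  by (simp add: Y_def em_scheme_initial)

lemma Y_step:
  "0 \<le> k \<Longrightarrow> Y (k + 1) \<omega> = (Y k \<omega> + h *\<^sub>R a (Y k \<omega>) (Y (prev k) \<omega>))
    + b (Y k \<omega>) (Y (prev k) \<omega>) *v (B (of_int (k + 1) * h) \<omega> - B (of_int k * h) \<omega>)"
  by (simp add: Y_def prev_def em_scheme_step)

lemma subalgebra_filtration: "0 \<le> t \<Longrightarrow> subalgebra M (\<F> t)"
  using filtration by (simp add: usual_filtration_def)

lemma filtration_mono: "\<lbrakk>0 \<le> s; s \<le> t\<rbrakk> \<Longrightarrow> subalgebra (\<F> t) (\<F> s)"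
  using filtration subalgebra_filtration[of s] subalgebra_filtration[of t]
  by (auto simp: usual_filtration_def subalgebra_def)

lemma Y_adapted: "\<lbrakk>n \<le> k; 0 \<le> k\<rbrakk> \<Longrightarrow> Y n \<in> borel_measurable (\<F> (of_int k * h))"
proof (induction "nat n" arbitrary: n k rule: less_induct)
  case less
  show ?case
  proof (cases "n \<le> 0")
    case True
    then have "Y n = (\<lambda>_. \<xi> (of_int n * h))" by (auto simp: Y_initial)
    then show ?thesis by simp
  next
    case False
    define m where "m = n - 1"
    have m: "n = m + 1" "0 \<le> m" using False by (auto simp: m_def)
    have Ym[measurable]: "Y m \<in> borel_measurable (\<F> (of_int k * h))"
      using m less.prems by (intro less.hyps) auto
    have Yp[measurable]: "Y (prev m) \<in> borel_measurable (\<F> (of_int k * h))"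
      using m less.prems prev_le[of m] by (intro less.hyps) auto
    have Bj[measurable]: "B (of_int j * h) \<in> borel_measurable (\<F> (of_int k * h))" if "0 \<le> j" "j \<le> k" for j
    proof (rule measurable_from_subalg[OF filtration_mono])
      show "0 \<le> of_int j * h" "of_int j * h \<le> of_int k * h" using that h_pos by auto
      then show "B (of_int j * h) \<in> borel_measurable (\<F> (of_int j * h))"
        using brownian by (simp add: brownian_motion_def)
    qed
    have "(\<lambda>\<omega>. a (Y m \<omega>) (Y (prev m) \<omega>)) \<in> borel_measurable (\<F> (of_int k * h))"
      "(\<lambda>\<omega>. b (Y m \<omega>) (Y (prev m) \<omega>)) \<in> borel_measurable (\<F> (of_int k * h))"
      by (rule borel_measurable_continuous_Pair[OF Ym Yp cont_a]
          borel_measurable_continuous_Pair[OF Ym Yp cont_b])+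
    moreover have "(\<lambda>\<omega>. B (of_int (m + 1) * h) \<omega> - B (of_int m * h) \<omega>) \<in> borel_measurable (\<F> (of_int k * h))"
      using m less.prems by (intro borel_measurable_diff Bj) auto
    ultimately have "(\<lambda>\<omega>. (Y m \<omega> + h *\<^sub>R a (Y m \<omega>) (Y (prev m) \<omega>))
        + b (Y m \<omega>) (Y (prev m) \<omega>) *v (B (of_int (m + 1) * h) \<omega> - B (of_int m * h) \<omega>))
      \<in> borel_measurable (\<F> (of_int k * h))"
      by (intro borel_measurable_add borel_measurable_scaleR borel_measurable_const
          borel_measurable_matrix_vector Ym)
    moreover have "Y n = (\<lambda>\<omega>. (Y m \<omega> + h *\<^sub>R a (Y m \<omega>) (Y (prev m) \<omega>))
        + b (Y m \<omega>) (Y (prev m) \<omega>) *v (B (of_int (m + 1) * h) \<omega> - B (of_int m * h) \<omega>))"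
      unfolding m(1) using Y_step[OF m(2)] by blast
    ultimately show ?thesis by (simp only:)
  qed
qed

lemma Y_measurable [measurable]: "Y n \<in> borel_measurable M"
proof (rule measurable_from_subalg[OF subalgebra_filtration])
  show "Y n \<in> borel_measurable (\<F> (of_int (max 0 n) * h))" by (rule Y_adapted) auto
  show "0 \<le> of_int (max 0 n) * h" using h_pos by (intro mult_nonneg_nonneg) auto
qed

lemma Y_step_second_moment:
  assumes k: "0 \<le> k" and int: "integrable M (\<lambda>\<omega>. (norm (Y k \<omega>))\<^sup>2)"
    "integrable M (\<lambda>\<omega>. (norm (Y (prev k) \<omega>))\<^sup>2)"
  shows "integrable M (\<lambda>\<omega>. (norm (Y (k + 1) \<omega>))\<^sup>2)"
    and "integrable M (\<lambda>\<omega>. (norm (Y k \<omega> + h *\<^sub>R a (Y k \<omega>) (Y (prev k) \<omega>)))\<^sup>2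
      + h * (norm (b (Y k \<omega>) (Y (prev k) \<omega>)))\<^sup>2)"
    and "expectation (\<lambda>\<omega>. (norm (Y (k + 1) \<omega>))\<^sup>2)
      = expectation (\<lambda>\<omega>. (norm (Y k \<omega> + h *\<^sub>R a (Y k \<omega>) (Y (prev k) \<omega>)))\<^sup>2
        + h * (norm (b (Y k \<omega>) (Y (prev k) \<omega>)))\<^sup>2)"
proof -
  let ?t = "of_int k * h" and ?a = "\<lambda>\<omega>. a (Y k \<omega>) (Y (prev k) \<omega>)" and ?b = "\<lambda>\<omega>. b (Y k \<omega>) (Y (prev k) \<omega>)"
  let ?x = "\<lambda>\<omega>. Y k \<omega> + h *\<^sub>R ?a \<omega>" and ?Z = "\<lambda>\<omega>. B (of_int (k + 1) * h) \<omega> - B ?t \<omega>"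
  have t: "0 \<le> ?t" "?t < of_int (k + 1) * h" using k h_pos by auto
  note sub = subalgebra_filtration[OF t(1)]
  note Yk = Y_adapted[OF order_refl k] and Yp = Y_adapted[OF prev_le k]
  have a_meas: "?a \<in> borel_measurable (\<F> ?t)"
    by (rule borel_measurable_continuous_Pair[OF Yk Yp cont_a])
  have b_meas: "?b \<in> borel_measurable (\<F> ?t)"
    by (rule borel_measurable_continuous_Pair[OF Yk Yp cont_b])
  have x_meas: "?x \<in> borel_measurable (\<F> ?t)"
    by (intro borel_measurable_add borel_measurable_scaleR borel_measurable_const Yk a_meas)
  have [measurable]: "?a \<in> borel_measurable M" "?b \<in> borel_measurable M"
    by (rule measurable_from_subalg[OF sub a_meas] measurable_from_subalg[OF sub b_meas])+
  have int_growth: "integrable M (\<lambda>\<omega>. K * ((norm (Y k \<omega>))\<^sup>2 + (norm (Y (prev k) \<omega>))\<^sup>2))"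
    using int by simp
  have int_a: "integrable M (\<lambda>\<omega>. (norm (?a \<omega>))\<^sup>2)"
    using int_growth by (rule Bochner_Integration.integrable_bound)
      (auto intro!: AE_I2 order_trans[OF growth_a abs_ge_self])
  have int_b: "integrable M (\<lambda>\<omega>. (norm (?b \<omega>))\<^sup>2)"
    using int_growth by (rule Bochner_Integration.integrable_bound)
      (auto intro!: AE_I2 order_trans[OF growth_b abs_ge_self])
  have int_x: "integrable M (\<lambda>\<omega>. (norm (?x \<omega>))\<^sup>2)"
  proof (rule Bochner_Integration.integrable_bound)
    show "integrable M (\<lambda>\<omega>. 2 * (norm (Y k \<omega>))\<^sup>2 + 2 * (h\<^sup>2 * (norm (?a \<omega>))\<^sup>2))"
      using int int_a by simp
    show "AE \<omega> in M. norm ((norm (?x \<omega>))\<^sup>2) \<le> norm (2 * (norm (Y k \<omega>))\<^sup>2 + 2 * (h\<^sup>2 * (norm (?a \<omega>))\<^sup>2))"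
    proof (rule AE_I2)
      fix \<omega>
      show "norm ((norm (?x \<omega>))\<^sup>2) \<le> norm (2 * (norm (Y k \<omega>))\<^sup>2 + 2 * (h\<^sup>2 * (norm (?a \<omega>))\<^sup>2))"
        using norm_add_square_le[of "Y k \<omega>" "h *\<^sub>R ?a \<omega>"] by (simp add: power_mult_distrib)
    qed
  qed simp
  note inc = brownian_increment[OF filtration brownian t]
  have "has_bochner_integral M (\<lambda>\<omega>. (norm (?x \<omega> + ?b \<omega> *v ?Z \<omega>))\<^sup>2)
    (expectation (\<lambda>\<omega>. (norm (?x \<omega>))\<^sup>2) + h * expectation (\<lambda>\<omega>. (norm (?b \<omega>))\<^sup>2))"
  proof (rule second_moment_add_noise[OF sub inc(1,2,3,4,5) _ x_meas b_meas int_x int_b])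
    show "expectation (\<lambda>\<omega>. ?Z \<omega> $ j * ?Z \<omega> $ l) = (if j = l then h else 0)" for j l
      using inc(6)[of j l] by (simp add: algebra_simps)
  qed
  moreover have "Y (k + 1) \<omega> = ?x \<omega> + ?b \<omega> *v ?Z \<omega>" for \<omega> by (rule Y_step[OF k])
  ultimately have hbi: "has_bochner_integral M (\<lambda>\<omega>. (norm (Y (k + 1) \<omega>))\<^sup>2)
    (expectation (\<lambda>\<omega>. (norm (?x \<omega>))\<^sup>2) + h * expectation (\<lambda>\<omega>. (norm (?b \<omega>))\<^sup>2))" by simp
  then show "integrable M (\<lambda>\<omega>. (norm (Y (k + 1) \<omega>))\<^sup>2)" by (simp add: has_bochner_integral_iff)
  show "integrable M (\<lambda>\<omega>. (norm (?x \<omega>))\<^sup>2 + h * (norm (?b \<omega>))\<^sup>2)" using int_x int_b by simp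
  show "expectation (\<lambda>\<omega>. (norm (Y (k + 1) \<omega>))\<^sup>2)
      = expectation (\<lambda>\<omega>. (norm (?x \<omega>))\<^sup>2 + h * (norm (?b \<omega>))\<^sup>2)"
    using hbi int_x int_b by (simp add: has_bochner_integral_iff)
qed

lemma Y_square_integrable: "integrable M (\<lambda>\<omega>. (norm (Y n \<omega>))\<^sup>2)"
proof (induction "nat n" arbitrary: n rule: less_induct)
  case less
  show ?case
  proof (cases "n \<le> 0")
    case True
    then show ?thesis by (simp add: Y_initial)
  next
    case False
    have "integrable M (\<lambda>\<omega>. (norm (Y ((n - 1) + 1) \<omega>))\<^sup>2)"
      using False prev_le[of "n - 1"] by (intro Y_step_second_moment(1) less.hyps) auto
    then show ?thesis by simp
  qed
qed

lemma Y_second_moment_le: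
  assumes "0 \<le> k" and \<psi>[measurable]: "\<psi> \<in> borel_measurable borel"
    and \<psi>_le: "\<And>x. \<bar>\<psi> x\<bar> \<le> C"
    and pointwise: "\<And>x y. (norm (x + h *\<^sub>R a x y))\<^sup>2 + h * (norm (b x y))\<^sup>2
      \<le> p * (norm x)\<^sup>2 + q * (norm y)\<^sup>2 - r * \<psi> x + s * \<psi> y"
  shows "expectation (\<lambda>\<omega>. (norm (Y (k + 1) \<omega>))\<^sup>2)
    \<le> p * expectation (\<lambda>\<omega>. (norm (Y k \<omega>))\<^sup>2) + q * expectation (\<lambda>\<omega>. (norm (Y (prev k) \<omega>))\<^sup>2)
      - r * expectation (\<lambda>\<omega>. \<psi> (Y k \<omega>)) + s * expectation (\<lambda>\<omega>. \<psi> (Y (prev k) \<omega>))"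
proof -
  have int_\<psi>: "integrable M (\<lambda>\<omega>. \<psi> (Y j \<omega>))" for j
    by (rule integrable_const_bound[of _ C]) (auto simp: \<psi>_le)
  note step = Y_step_second_moment[OF \<open>0 \<le> k\<close> Y_square_integrable Y_square_integrable]
  have "expectation (\<lambda>\<omega>. (norm (Y (k + 1) \<omega>))\<^sup>2) \<le> expectation (\<lambda>\<omega>. p * (norm (Y k \<omega>))\<^sup>2
      + q * (norm (Y (prev k) \<omega>))\<^sup>2 - r * \<psi> (Y k \<omega>) + s * \<psi> (Y (prev k) \<omega>))"
    unfolding step(3) using step(2) int_\<psi> Y_square_integrable pointwise
    by (intro integral_mono) auto
  also have "\<dots> = p * expectation (\<lambda>\<omega>. (norm (Y k \<omega>))\<^sup>2) + q * expectation (\<lambda>\<omega>. (norm (Y (prev k) \<omega>))\<^sup>2)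
      - r * expectation (\<lambda>\<omega>. \<psi> (Y k \<omega>)) + s * expectation (\<lambda>\<omega>. \<psi> (Y (prev k) \<omega>))"
    using int_\<psi> Y_square_integrable by simp
  finally show ?thesis .
qed

end

section \<open>The growth condition under truncation\<close>

text \<open>Outside the ball, \<open>x\<close> is the multiple \<open>|x| / \<rho> \<ge> 1\<close> of its truncation, so the growth
  bound at the truncated point gets multiplied by this factor.\<close>

lemma trunc_growth_outside:
  fixes F :: "real ^ 'd \<Rightarrow> real ^ 'd \<Rightarrow> real ^ 'd" and G :: "real ^ 'd \<Rightarrow> real ^ 'd \<Rightarrow> real ^ 'm ^ 'd"
  assumes "0 < \<rho>" "\<rho> < norm x" "0 \<le> c"
    and "2 * (trunc \<rho> x \<bullet> F (trunc \<rho> x) y) + c * (norm (G (trunc \<rho> x) y))\<^sup>2 \<le> W"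
  shows "2 * (x \<bullet> F (trunc \<rho> x) y) + c * (norm (G (trunc \<rho> x) y))\<^sup>2 \<le> norm x / \<rho> * W"
proof -
  let ?r = "norm x / \<rho>" and ?g = "c * (norm (G (trunc \<rho> x) y))\<^sup>2"
  have r: "1 \<le> ?r" using assms by simp
  have "0 \<le> ?g" using assms by simp
  then have "1 * ?g \<le> ?r * ?g" using r by (intro mult_right_mono) auto
  moreover have "x \<bullet> F (trunc \<rho> x) y = ?r * (trunc \<rho> x \<bullet> F (trunc \<rho> x) y)"
    using trunc_outside[of \<rho> x] assms by (metis inner_scaleR_left less_imp_le)
  ultimately have "2 * (x \<bullet> F (trunc \<rho> x) y) + ?g \<le> ?r * (2 * (trunc \<rho> x \<bullet> F (trunc \<rho> x) y) + ?g)"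
    by (simp add: algebra_simps)
  also have "\<dots> \<le> ?r * W" using r assms(4) by (intro mult_left_mono) auto
  finally show ?thesis .
qed

text \<open>If the dissipative power dominates on the sphere of radius \<open>\<rho>\<close>, then the factor
  \<open>|x| / \<rho>\<close> multiplies a nonpositive quantity, apart from the term with \<open>\<alpha>\<^sub>1\<close>, for which
  \<open>\<rho> |x| \<le> |x|\<^sup>2\<close> is enough.\<close>

lemma trunc_growth_dissipative:
  fixes F :: "real ^ 'd \<Rightarrow> real ^ 'd \<Rightarrow> real ^ 'd" and G :: "real ^ 'd \<Rightarrow> real ^ 'd \<Rightarrow> real ^ 'm ^ 'd"
  assumes \<rho>: "0 < \<rho>" and "0 \<le> c" "0 \<le> \<alpha>1" "0 \<le> \<alpha>2" "0 \<le> \<alpha>4" "0 \<le> \<beta>"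
    and growth: "\<And>x y. 2 * (x \<bullet> F x y) + c * (norm (G x y))\<^sup>2
      \<le> \<alpha>1 * (norm x)\<^sup>2 + \<alpha>2 * (norm y)\<^sup>2 - \<alpha>3 * norm x powr \<beta> + \<alpha>4 * norm y powr \<beta>"
    and dissipative: "\<alpha>2 * \<rho>\<^sup>2 + \<alpha>4 * \<rho> powr \<beta> \<le> \<alpha>3 * \<rho> powr \<beta>"
  shows "2 * (x \<bullet> F (trunc \<rho> x) (trunc \<rho> y)) + c * (norm (G (trunc \<rho> x) (trunc \<rho> y)))\<^sup>2
    \<le> \<alpha>1 * (norm x)\<^sup>2 + \<alpha>2 * (norm y)\<^sup>2 - \<alpha>3 * norm (trunc \<rho> x) powr \<beta> + \<alpha>4 * norm (trunc \<rho> y) powr \<beta>"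
proof -
  let ?x = "trunc \<rho> x" and ?y = "trunc \<rho> y"
  let ?L = "2 * (x \<bullet> F ?x ?y) + c * (norm (G ?x ?y))\<^sup>2"
  have "norm ?y \<le> norm y" using \<rho> by (simp add: norm_trunc)
  then have y: "\<alpha>2 * (norm ?y)\<^sup>2 \<le> \<alpha>2 * (norm y)\<^sup>2"
    using \<open>0 \<le> \<alpha>2\<close> by (intro mult_left_mono power_mono) auto
  show ?thesis
  proof (cases "norm x \<le> \<rho>")
    case True
    then show ?thesis using growth[of ?x ?y] y by (simp add: trunc_inside)
  next
    case False
    then have x: "\<rho> < norm x" "norm ?x = \<rho>" using \<rho> by (auto simp: norm_trunc)
    let ?r = "norm x / \<rho>" and ?W = "\<alpha>2 * (norm ?y)\<^sup>2 - \<alpha>3 * \<rho> powr \<beta> + \<alpha>4 * norm ?y powr \<beta>"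
    have "norm ?y \<le> \<rho>" using \<rho> by (simp add: norm_trunc)
    then have "\<alpha>2 * (norm ?y)\<^sup>2 \<le> \<alpha>2 * \<rho>\<^sup>2" "\<alpha>4 * norm ?y powr \<beta> \<le> \<alpha>4 * \<rho> powr \<beta>"
      using assms by (auto intro!: mult_left_mono power_mono powr_mono2)
    then have W: "?W \<le> 0" using dissipative by linarith
    have "?L \<le> ?r * (\<alpha>1 * \<rho>\<^sup>2 + ?W)"
      using growth[of ?x ?y] x by (intro trunc_growth_outside) (use assms in auto)
    also have "\<dots> = \<alpha>1 * (norm x * \<rho>) + ?r * ?W"
      using \<rho> by (simp add: power2_eq_square distrib_left)
    also have "\<dots> \<le> \<alpha>1 * (norm x)\<^sup>2 + 1 * ?W"
    proof (rule add_mono)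
      show "\<alpha>1 * (norm x * \<rho>) \<le> \<alpha>1 * (norm x)\<^sup>2"
        using x(1) \<open>0 \<le> \<alpha>1\<close> by (auto simp: power2_eq_square intro!: mult_left_mono)
      show "?r * ?W \<le> 1 * ?W" using W x \<rho> by (intro mult_right_mono_neg) auto
    qed
    finally show ?thesis using y unfolding x(2) mult_1_left by linarith
  qed
qed

text \<open>Otherwise \<open>(\<alpha>\<^sub>3 - \<alpha>\<^sub>4) \<rho>\<^sup>\<beta> < \<alpha>\<^sub>2 \<rho>\<^sup>2\<close>. Then within the ball the power \<open>\<alpha>\<^sub>4 |y|\<^sup>\<beta>\<close> is at
  most \<open>a |y|\<^sup>2\<close> for some \<open>a < \<alpha>\<^sub>2\<close>, hence it joins the quadratic terms. For \<open>|x| > \<rho>\<close> the factor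
  \<open>|x| / \<rho>\<close> costs at most \<open>(\<alpha>\<^sub>2 - a) \<rho> |x|\<close>, which is split by Young's inequality. The weights
  of \<open>|x|\<^sup>2\<close> and \<open>|y|\<^sup>2\<close> that are used up sum to \<open>\<kappa> \<alpha>\<^sub>2\<close>.\<close>

lemma trunc_growth_quadratic:
  fixes F :: "real ^ 'd \<Rightarrow> real ^ 'd \<Rightarrow> real ^ 'd" and G :: "real ^ 'd \<Rightarrow> real ^ 'd \<Rightarrow> real ^ 'm ^ 'd"
  assumes \<rho>: "0 < \<rho>" and "0 \<le> c" "0 \<le> \<alpha>1" "0 \<le> \<alpha>2" "0 \<le> \<alpha>4" "2 < \<beta>" "2 \<le> \<kappa>"
    and \<alpha>3: "\<kappa> * \<alpha>4 \<le> \<alpha>3"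
    and growth: "\<And>x y. 2 * (x \<bullet> F x y) + c * (norm (G x y))\<^sup>2
      \<le> \<alpha>1 * (norm x)\<^sup>2 + \<alpha>2 * (norm y)\<^sup>2 - \<alpha>3 * norm x powr \<beta> + \<alpha>4 * norm y powr \<beta>"
    and weak: "\<alpha>3 * \<rho> powr \<beta> < \<alpha>2 * \<rho>\<^sup>2 + \<alpha>4 * \<rho> powr \<beta>"
  obtains \<eta> q where "0 \<le> \<eta>" "0 \<le> q" "\<eta> + q = \<kappa> * \<alpha>2"
    and "\<And>x y. 2 * (x \<bullet> F (trunc \<rho> x) (trunc \<rho> y)) + c * (norm (G (trunc \<rho> x) (trunc \<rho> y)))\<^sup>2
      \<le> (\<alpha>1 + \<eta>) * (norm x)\<^sup>2 + q * (norm y)\<^sup>2"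
proof -
  define P where "P = \<rho> powr (\<beta> - 2)"
  have powr_split: "t powr \<beta> = t powr (\<beta> - 2) * t\<^sup>2" if "0 \<le> t" for t :: real
  proof (cases "t = 0")
    case False
    then have "t powr (\<beta> - 2) * t powr 2 = t powr \<beta>" by (simp add: powr_add[symmetric])
    then show ?thesis using False that by (simp add: powr_numeral)
  qed (use \<open>2 < \<beta>\<close> in simp)
  define a where "a = \<alpha>4 * P"
  define b where "b = \<alpha>3 * P"
  have P: "0 < P" "\<rho> powr \<beta> = P * \<rho>\<^sup>2" using \<rho> powr_split[of \<rho>] by (auto simp: P_def)
  have a: "0 \<le> a" using P \<open>0 \<le> \<alpha>4\<close> by (simp add: a_def)
  have "b * \<rho>\<^sup>2 < (\<alpha>2 + a) * \<rho>\<^sup>2" using weak by (simp add: a_def b_def P(2) algebra_simps)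
  then have b: "b < \<alpha>2 + a" using \<rho> by simp
  have "2 * \<alpha>4 \<le> \<kappa> * \<alpha>4" using \<open>0 \<le> \<alpha>4\<close> \<open>2 \<le> \<kappa>\<close> by (intro mult_right_mono)
  with \<alpha>3 have "2 * \<alpha>4 \<le> \<alpha>3" by simp
  then have ab: "2 * a \<le> b" using P mult_right_mono[of "2 * \<alpha>4" \<alpha>3 P] by (simp add: a_def b_def)
  define q where "q = \<alpha>2 + a"
  define \<eta> where "\<eta> = \<kappa> * \<alpha>2 - q"
  have "2 * \<alpha>2 \<le> \<kappa> * \<alpha>2" using \<open>0 \<le> \<alpha>2\<close> \<open>2 \<le> \<kappa>\<close> by (intro mult_right_mono)
  then have \<eta>: "\<alpha>2 - a \<le> \<eta>" by (simp add: \<eta>_def q_def)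
  have a_less: "a < \<alpha>2" using ab b by simp
  have \<alpha>3_pos: "0 \<le> \<alpha>3" using \<open>2 * \<alpha>4 \<le> \<alpha>3\<close> \<open>0 \<le> \<alpha>4\<close> by simp
  show thesis
  proof (rule that[of \<eta> q])
    show "0 \<le> \<eta>" "0 \<le> q" "\<eta> + q = \<kappa> * \<alpha>2"
      using \<eta> a a_less \<open>0 \<le> \<alpha>2\<close> unfolding \<eta>_def q_def by linarith+
    fix x y :: "real ^ 'd"
    let ?x = "trunc \<rho> x" and ?y = "trunc \<rho> y"
    let ?L = "2 * (x \<bullet> F ?x ?y) + c * (norm (G ?x ?y))\<^sup>2"
    have y_le: "norm ?y \<le> norm y" "norm ?y \<le> \<rho>" using \<rho> by (auto simp: norm_trunc)
    then have "norm ?y powr (\<beta> - 2) \<le> P" unfolding P_def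
      using \<open>2 < \<beta>\<close> by (intro powr_mono2) auto
    then have "\<alpha>4 * (norm ?y powr (\<beta> - 2) * (norm ?y)\<^sup>2) \<le> \<alpha>4 * (P * (norm ?y)\<^sup>2)"
      using \<open>0 \<le> \<alpha>4\<close> by (intro mult_left_mono mult_right_mono) auto
    then have y4: "\<alpha>4 * norm ?y powr \<beta> \<le> a * (norm ?y)\<^sup>2"
      by (simp add: powr_split a_def)
    have yq: "q * (norm ?y)\<^sup>2 \<le> q * (norm y)\<^sup>2"
      using \<open>0 \<le> q\<close> y_le by (intro mult_left_mono power_mono) auto
    show "?L \<le> (\<alpha>1 + \<eta>) * (norm x)\<^sup>2 + q * (norm y)\<^sup>2"
    proof (cases "norm x \<le> \<rho>")
      case True
      have "0 \<le> \<alpha>3 * norm x powr \<beta>" "0 \<le> \<eta> * (norm x)\<^sup>2" using \<alpha>3_pos \<open>0 \<le> \<eta>\<close> by auto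
      then show ?thesis using True growth[of ?x ?y] y4 yq
        by (simp add: trunc_inside q_def algebra_simps)
    next
      case False
      let ?X = "norm x" and ?s = "(norm ?y)\<^sup>2"
      have x: "\<rho> < ?X" "norm ?x = \<rho>" using False \<rho> by (auto simp: norm_trunc)
      have "2 * (?x \<bullet> F ?x ?y) + c * (norm (G ?x ?y))\<^sup>2 \<le> \<alpha>1 * \<rho>\<^sup>2 + (q * ?s - b * \<rho>\<^sup>2)"
        using growth[of ?x ?y] y4 x(2) by (simp add: q_def b_def P(2) algebra_simps)
      then have "?L \<le> ?X / \<rho> * (\<alpha>1 * \<rho>\<^sup>2 + (q * ?s - b * \<rho>\<^sup>2))"
        by (intro trunc_growth_outside[OF \<rho> x(1) \<open>0 \<le> c\<close>])
      also have "\<dots> = \<alpha>1 * (?X * \<rho>) + q * (?s * (?X / \<rho> - 1)) + q * ?s - b * (?X * \<rho>)"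
        using \<rho> by (simp add: power2_eq_square field_simps)
      also have "\<dots> \<le> \<alpha>1 * ?X\<^sup>2 + q * (\<rho>\<^sup>2 * (?X / \<rho> - 1)) + q * (norm y)\<^sup>2 - b * (?X * \<rho>)"
      proof -
        have "\<alpha>1 * (?X * \<rho>) \<le> \<alpha>1 * ?X\<^sup>2"
          using x \<open>0 \<le> \<alpha>1\<close> by (auto simp: power2_eq_square intro!: mult_left_mono)
        moreover have "q * (?s * (?X / \<rho> - 1)) \<le> q * (\<rho>\<^sup>2 * (?X / \<rho> - 1))"
          using x \<rho> y_le \<open>0 \<le> q\<close> by (intro mult_left_mono mult_right_mono power_mono) auto
        ultimately show ?thesis using yq by linarith
      qed
      also have "q * (\<rho>\<^sup>2 * (?X / \<rho> - 1)) = q * (?X * \<rho>) - q * \<rho>\<^sup>2"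
        using \<rho> by (simp add: power2_eq_square field_simps)
      finally have L: "?L \<le> \<alpha>1 * ?X\<^sup>2 + ((q - b) * (?X * \<rho>) - q * \<rho>\<^sup>2) + q * (norm y)\<^sup>2"
        by (simp add: algebra_simps)
      have "(q - b) * (?X * \<rho>) \<le> (\<alpha>2 - a) * (?X\<^sup>2 + \<rho>\<^sup>2)"
      proof -
        have "(q - b) * (?X * \<rho>) \<le> (\<alpha>2 - a) * (?X * \<rho>)"
          using ab \<rho> by (intro mult_right_mono) (auto simp: q_def)
        also have "?X * \<rho> \<le> ?X\<^sup>2 + \<rho>\<^sup>2"
        proof -
          have "0 \<le> ?X * \<rho>" using \<rho> by simp
          then show ?thesis using sum_squares_bound[of ?X \<rho>] by linarith
        qed
        finally show ?thesis using a_less by simp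
      qed
      also have "\<dots> \<le> \<eta> * ?X\<^sup>2 + q * \<rho>\<^sup>2"
      proof -
        have "(\<alpha>2 - a) * ?X\<^sup>2 \<le> \<eta> * ?X\<^sup>2" using \<eta> by (intro mult_right_mono) auto
        moreover have "(\<alpha>2 - a) * \<rho>\<^sup>2 \<le> q * \<rho>\<^sup>2" using a by (intro mult_right_mono) (auto simp: q_def)
        ultimately show ?thesis by (simp add: distrib_left)
      qed
      finally show ?thesis using L by (simp add: algebra_simps)
    qed
  qed
qed

section \<open>Exponential decay of the scheme\<close>

lemma norm_step_square:
  fixes x u :: "'c::real_inner"
  shows "(norm (x + h *\<^sub>R u))\<^sup>2 = (norm x)\<^sup>2 + h * (2 * (x \<bullet> u) + h * (norm u)\<^sup>2)"
  unfolding power2_norm_eq_inner by (simp add: inner_simps inner_commute algebra_simps)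

text \<open>In the dissipative case the power terms have to be balanced over time, which takes the
  summation argument with its factor \<open>\<kappa>\<close>. In the other case they are gone, and the Halanay
  argument counts each delayed value only once. As \<open>\<kappa> \<ge> 2\<close>, the rate equation has a surplus of
  \<open>(\<kappa> - 1) \<alpha>\<^sub>2\<close>, which covers the loss caused by truncation.\<close>

lemma (in driven_scheme) truncated_scheme_decay:
  assumes a: "a = partial_trunc F1 F \<rho>" and b: "b = partial_trunc G1 G \<rho>" and \<rho>: "0 < \<rho>"
    and \<tau>: "\<tau> = real N * h" and steps: "\<And>k. delay_steps \<delta> h (int k) \<le> N"
    and fibre: "\<And>n j. real (card {k. k < n \<and> int k - int (delay_steps \<delta> h (int k)) = j}) \<le> \<kappa>"
    and "2 \<le> \<kappa>" and nonneg: "0 \<le> c1" "0 \<le> c2" "0 \<le> lam2" "0 \<le> \<alpha>1" "0 \<le> \<alpha>2" "0 \<le> \<alpha>4" "0 \<le> \<gamma>"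
    and "2 < \<beta>"
    and growth1: "\<And>x y. 2 * (x \<bullet> F1 x y) + c1 * (norm (G1 x y))\<^sup>2
      \<le> - lam1 * (norm x)\<^sup>2 + lam2 * (norm y)\<^sup>2"
    and growth: "\<And>x y. 2 * (x \<bullet> F x y) + c2 * (norm (G x y))\<^sup>2
      \<le> \<alpha>1 * (norm x)\<^sup>2 + \<alpha>2 * (norm y)\<^sup>2 - \<alpha>3 * norm x powr \<beta> + \<alpha>4 * norm y powr \<beta>"
    and young: "\<And>x y u v. (norm (G1 x y + G u v))\<^sup>2 \<le> c1 * (norm (G1 x y))\<^sup>2 + c2 * (norm (G u v))\<^sup>2"
    and drift: "\<And>x y. h * (norm (a x y))\<^sup>2 \<le> e * ((norm x)\<^sup>2 + (norm y)\<^sup>2)" and "0 \<le> e"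
    and small: "h * lam1 \<le> 1"
    and rate: "\<alpha>1 + e + \<kappa> * (lam2 + \<alpha>2 + e) * exp (\<gamma> * \<tau>) + (1 - exp (- \<gamma> * h)) / h \<le> lam1"
    and balance: "\<kappa> * \<alpha>4 * exp (\<gamma> * \<tau>) \<le> \<alpha>3"
  shows "\<exists>K>0. \<forall>k. expectation (\<lambda>\<omega>. (norm (Y (int k) \<omega>))\<^sup>2) \<le> K * exp (- \<gamma> * (real k * h))"
proof -
  let ?w = "\<lambda>j. expectation (\<lambda>\<omega>. (norm (Y j \<omega>))\<^sup>2)" and ?E = "exp (\<gamma> * \<tau>)"
  let ?r = "(1 - exp (- \<gamma> * h)) / h"
  have w: "0 \<le> ?w j" for j by simp
  have "0 \<le> \<tau>" using h_pos by (simp add: \<tau>)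
  then have E: "1 \<le> ?E" using nonneg by simp
  have one_step: "(norm (x + h *\<^sub>R a x y))\<^sup>2 + h * (norm (b x y))\<^sup>2
      \<le> (norm x)\<^sup>2 + h * (- lam1 * (norm x)\<^sup>2 + lam2 * (norm y)\<^sup>2 + Q + e * ((norm x)\<^sup>2 + (norm y)\<^sup>2))"
    if "2 * (x \<bullet> F (trunc \<rho> x) (trunc \<rho> y)) + c2 * (norm (G (trunc \<rho> x) (trunc \<rho> y)))\<^sup>2 \<le> Q"
    for x y Q
  proof -
    have "x \<bullet> a x y = x \<bullet> F1 x y + x \<bullet> F (trunc \<rho> x) (trunc \<rho> y)"
      by (simp add: a partial_trunc_def inner_add_right)
    moreover have "(norm (b x y))\<^sup>2 \<le> c1 * (norm (G1 x y))\<^sup>2 + c2 * (norm (G (trunc \<rho> x) (trunc \<rho> y)))\<^sup>2"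
      unfolding b partial_trunc_def by (rule young)
    ultimately have "2 * (x \<bullet> a x y) + h * (norm (a x y))\<^sup>2 + (norm (b x y))\<^sup>2
        \<le> - lam1 * (norm x)\<^sup>2 + lam2 * (norm y)\<^sup>2 + Q + e * ((norm x)\<^sup>2 + (norm y)\<^sup>2)"
      using growth1[of x y] drift[of x y] that by linarith
    then have "h * (2 * (x \<bullet> a x y) + h * (norm (a x y))\<^sup>2 + (norm (b x y))\<^sup>2)
        \<le> h * (- lam1 * (norm x)\<^sup>2 + lam2 * (norm y)\<^sup>2 + Q + e * ((norm x)\<^sup>2 + (norm y)\<^sup>2))"
      using h_pos by (intro mult_left_mono) auto
    then show ?thesis unfolding norm_step_square by (simp add: algebra_simps)
  qed
  have "\<alpha>4 \<le> \<kappa> * \<alpha>4 * ?E \<and> \<kappa> * \<alpha>4 \<le> \<kappa> * \<alpha>4 * ?E"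
  proof
    show *: "\<kappa> * \<alpha>4 \<le> \<kappa> * \<alpha>4 * ?E"
      using mult_left_mono[OF E, of "\<kappa> * \<alpha>4"] nonneg \<open>2 \<le> \<kappa>\<close> by simp
    have "1 * \<alpha>4 \<le> \<kappa> * \<alpha>4" using nonneg \<open>2 \<le> \<kappa>\<close> by (intro mult_right_mono) auto
    with * show "\<alpha>4 \<le> \<kappa> * \<alpha>4 * ?E" by simp
  qed
  with balance have \<alpha>3: "\<kappa> * \<alpha>4 \<le> \<alpha>3" by simp
  show ?thesis
  proof (cases "\<alpha>2 * \<rho>\<^sup>2 + \<alpha>4 * \<rho> powr \<beta> \<le> \<alpha>3 * \<rho> powr \<beta>")
    case True
    let ?\<psi> = "\<lambda>x :: real ^ 'd. norm (trunc \<rho> x) powr \<beta>"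
    have \<psi>_meas: "?\<psi> \<in> borel_measurable borel"
    proof -
      have [measurable]: "(\<lambda>x. trunc \<rho> x) \<in> borel_measurable (borel :: (real ^ 'd) measure)"
        using \<rho> by (intro borel_measurable_continuous_onI continuous_on_trunc continuous_on_id)
      show ?thesis by measurable
    qed
    have \<psi>_le: "\<bar>?\<psi> x\<bar> \<le> \<rho> powr \<beta>" for x :: "real ^ 'd"
      using \<rho> \<open>2 < \<beta>\<close> by (auto simp: norm_trunc intro!: powr_mono2)
    let ?A = "lam1 - \<alpha>1 - e" and ?C = "lam2 + \<alpha>2 + e"
    show ?thesis
    proof (rule summed_decay[where A = ?A and C = ?C and a = \<alpha>3 and b = \<alpha>4 and \<kappa> = \<kappa> and \<tau> = \<tau>
          and v = "\<lambda>j. expectation (\<lambda>\<omega>. ?\<psi> (Y j \<omega>))", OF h_pos _ _ _ _ \<tau> _ balance w _ steps fibre])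
      fix k :: nat
      have "?w (int k + 1) \<le> (1 - h * ?A) * ?w (int k) + h * ?C * ?w (prev (int k))
        - h * \<alpha>3 * expectation (\<lambda>\<omega>. ?\<psi> (Y (int k) \<omega>)) + h * \<alpha>4 * expectation (\<lambda>\<omega>. ?\<psi> (Y (prev (int k)) \<omega>))"
      proof (rule Y_second_moment_le[OF _ \<psi>_meas \<psi>_le])
        fix x y
        show "(norm (x + h *\<^sub>R a x y))\<^sup>2 + h * (norm (b x y))\<^sup>2 \<le> (1 - h * ?A) * (norm x)\<^sup>2
            + h * ?C * (norm y)\<^sup>2 - h * \<alpha>3 * ?\<psi> x + h * \<alpha>4 * ?\<psi> y"
          using one_step[OF trunc_growth_dissipative[OF \<rho> nonneg(2,4,5,6) _ growth True], of x y]
            \<open>2 < \<beta>\<close> by (simp add: algebra_simps)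
      qed simp
      then show "?w (int k + 1) \<le> (1 - h * ?A) * ?w (int k)
          + h * ?C * ?w (int k - int (delay_steps \<delta> h (int k)))
          - h * \<alpha>3 * expectation (\<lambda>\<omega>. ?\<psi> (Y (int k) \<omega>))
          + h * \<alpha>4 * expectation (\<lambda>\<omega>. ?\<psi> (Y (int k - int (delay_steps \<delta> h (int k))) \<omega>))"
        by (simp add: prev_def)
    next
      show "\<kappa> * ?C * ?E + ?r \<le> ?A" using rate by simp
    qed (use nonneg \<open>0 \<le> e\<close> \<open>2 \<le> \<kappa>\<close> in auto)
  next
    case False
    then have weak: "\<alpha>3 * \<rho> powr \<beta> < \<alpha>2 * \<rho>\<^sup>2 + \<alpha>4 * \<rho> powr \<beta>" by simp
    obtain \<eta> q where \<eta>: "0 \<le> \<eta>" "0 \<le> q" "\<eta> + q = \<kappa> * \<alpha>2"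
      and bound: "\<And>x y. 2 * (x \<bullet> F (trunc \<rho> x) (trunc \<rho> y)) + c2 * (norm (G (trunc \<rho> x) (trunc \<rho> y)))\<^sup>2
        \<le> (\<alpha>1 + \<eta>) * (norm x)\<^sup>2 + q * (norm y)\<^sup>2"
      using trunc_growth_quadratic[OF \<rho> nonneg(2,4,5,6) \<open>2 < \<beta>\<close> \<open>2 \<le> \<kappa>\<close> \<alpha>3 growth weak] by metis
    let ?c1 = "1 - h * (lam1 - \<alpha>1 - \<eta> - e)" and ?c2 = "h * (lam2 + q + e)"
    show ?thesis
    proof (rule halanay_decay[where ?c1.0 = ?c1 and ?c2.0 = ?c2 and \<tau> = \<tau>, OF h_pos _ _ _ \<tau> _ w steps])
      show "0 \<le> ?c1"
      proof -
        have "0 \<le> h * (\<alpha>1 + \<eta> + e)" using h_pos nonneg \<eta> \<open>0 \<le> e\<close> by simp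
        with small show ?thesis by (simp add: algebra_simps)
      qed
      show "?c1 + ?c2 * ?E \<le> exp (- \<gamma> * h)"
      proof -
        have "\<eta> + (lam2 + q + e) * ?E \<le> \<kappa> * (lam2 + \<alpha>2 + e) * ?E"
        proof -
          have "1 * (lam2 + e) \<le> \<kappa> * (lam2 + e)"
            using nonneg \<open>0 \<le> e\<close> \<open>2 \<le> \<kappa>\<close> by (intro mult_right_mono) auto
          then have "\<eta> + lam2 + q + e \<le> \<kappa> * (lam2 + \<alpha>2 + e)" using \<eta>(3) by (simp add: algebra_simps)
          then have "(\<eta> + lam2 + q + e) * ?E \<le> \<kappa> * (lam2 + \<alpha>2 + e) * ?E"
            by (intro mult_right_mono) auto
          moreover have "\<eta> * 1 \<le> \<eta> * ?E" using E \<eta> by (intro mult_left_mono)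
          ultimately show ?thesis by (simp add: algebra_simps)
        qed
        with rate have "(\<eta> + (lam2 + q + e) * ?E + \<alpha>1 + e) + ?r \<le> lam1" by linarith
        then have "h * ((\<eta> + (lam2 + q + e) * ?E + \<alpha>1 + e) + ?r) \<le> h * lam1"
          using h_pos by (intro mult_left_mono) auto
        moreover have "h * ?r = 1 - exp (- \<gamma> * h)" using h_pos by simp
        ultimately show ?thesis by (simp only: distrib_left) (simp add: algebra_simps)
      qed
      fix k :: nat
      have "?w (int k + 1) \<le> ?c1 * ?w (int k) + ?c2 * ?w (prev (int k))
        - 0 * expectation (\<lambda>\<omega>. (\<lambda>_. 0) (Y (int k) \<omega>)) + 0 * expectation (\<lambda>\<omega>. (\<lambda>_. 0) (Y (prev (int k)) \<omega>))"
      proof (rule Y_second_moment_le)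
        fix x y
        show "(norm (x + h *\<^sub>R a x y))\<^sup>2 + h * (norm (b x y))\<^sup>2
            \<le> ?c1 * (norm x)\<^sup>2 + ?c2 * (norm y)\<^sup>2 - 0 * 0 + 0 * 0"
          using one_step[OF bound, of x y] by (simp add: algebra_simps)
      qed auto
      then show "?w (int k + 1) \<le> ?c1 * ?w (int k) + ?c2 * ?w (int k - int (delay_steps \<delta> h (int k)))"
        by (simp add: prev_def)
    qed (use nonneg \<eta> h_pos \<open>0 \<le> e\<close> in auto)
  qed
qed

section \<open>Stability of the partially truncated scheme\<close>

theorem theorem5p5:
  fixes M :: "'a measure" and \<F> :: "real \<Rightarrow> 'a measure" and B :: "real \<Rightarrow> 'a \<Rightarrow> real ^ 'm"
    and F1 F f :: "real ^ 'd \<Rightarrow> real ^ 'd \<Rightarrow> real ^ 'd"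
    and G1 G g :: "real ^ 'd \<Rightarrow> real ^ 'd \<Rightarrow> real ^ 'm ^ 'd"
    and \<tau> \<delta>hat :: real and \<delta> \<delta>' :: "real \<Rightarrow> real"
    and \<mu> \<phi> eps :: "real \<Rightarrow> real" and hhat :: real
    and L :: real and LR :: "real \<Rightarrow> real"
    and \<theta> :: ereal and lam1 lam2 \<alpha>1 \<alpha>2 \<alpha>3 \<alpha>4 \<beta> \<kappa> \<Delta>star :: real
  assumes "prob_space M" and "complete_measure M"
    and "usual_filtration M \<F>" and "brownian_motion M \<F> B"
    and "\<tau> > 0"
    and f: "f = (\<lambda>x y. F1 x y + F x y)" and g: "g = (\<lambda>x y. G1 x y + G x y)"
    and "F1 0 0 = 0" and "F 0 0 = 0" and "G1 0 0 = 0" and "G 0 0 = 0"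
    and \<kappa>: "\<kappa> = of_int (\<lfloor>1 / (1 - \<delta>hat)\<rfloor> + 1)"
    \<comment> \<open>truncation data\<close>
    and "strict_mono_on {0..} \<mu>" and "continuous_on {0..} \<mu>" and "\<forall>r\<ge>0. \<mu> r \<ge> 0"
    and "filterlim \<mu> at_top at_top"
    and "\<forall>r\<ge>1. \<forall>x y. max (norm x) (norm y) \<le> r \<longrightarrow>
           max (norm (f x y) / (1 + norm x + norm y)) (norm (g x y) / (1 + norm x + norm y)) \<le> \<mu> r"
    and "hhat \<ge> max 1 (\<mu> 1)"
    and "\<forall>h\<in>{0<..1}. \<phi> h \<ge> \<mu> 1"
    and "\<forall>h\<in>{0<..1}. \<forall>k\<in>{0<..1}. h < k \<longrightarrow> \<phi> k < \<phi> h"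
    and "filterlim \<phi> at_top (at_right 0)"
    and "\<forall>h\<in>{0<..1}. h powr (1/4) * \<phi> h \<le> hhat"
    \<comment> \<open>(i)\<close>
    and "\<forall>x1 x2 y1 y2. max ((norm (F1 x1 y1 - F1 x2 y2))\<^sup>2) ((norm (G1 x1 y1 - G1 x2 y2))\<^sup>2)
           \<le> L * ((norm (x1 - x2))\<^sup>2 + (norm (y1 - y2))\<^sup>2)"
    and "\<forall>R>0. \<forall>x1 x2 y1 y2.
           max (max (norm x1) (norm x2)) (max (norm y1) (norm y2)) \<le> R \<longrightarrow>
           max ((norm (F x1 y1 - F x2 y2))\<^sup>2) ((norm (G x1 y1 - G x2 y2))\<^sup>2)
           \<le> LR R * ((norm (x1 - x2))\<^sup>2 + (norm (y1 - y2))\<^sup>2)"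
    \<comment> \<open>(ii)\<close>
    and "\<theta> \<ge> 0" and "lam1 \<ge> 0" and "lam2 \<ge> 0"
    and "\<alpha>1 \<ge> 0" and "\<alpha>2 \<ge> 0" and "\<alpha>3 \<ge> 0" and "\<alpha>4 \<ge> 0" and "\<beta> > 2"
    and "growth_bound (1 + \<theta>) F1 G1 (\<lambda>x y. - lam1 * (norm x)\<^sup>2 + lam2 * (norm y)\<^sup>2)"
    and "growth_bound (1 + inverse \<theta>) F G
           (\<lambda>x y. \<alpha>1 * (norm x)\<^sup>2 + \<alpha>2 * (norm y)\<^sup>2
                  - \<alpha>3 * norm x powr \<beta> + \<alpha>4 * norm y powr \<beta>)"
    \<comment> \<open>(iii)\<close>
    and "0 \<le> \<delta>hat" and "\<delta>hat < 1"
    and "\<forall>t\<ge>0. \<delta> t \<in> {0..\<tau>}"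
    and "\<forall>t\<ge>0. (\<delta> has_real_derivative \<delta>' t) (at t within {0..})"
    and "continuous_on {0..} \<delta>'"
    and "\<forall>t\<ge>0. \<bar>\<delta>' t\<bar> \<le> \<delta>hat"
    \<comment> \<open>(iv)\<close>
    and "lam1 > \<alpha>1 + 1/4 * lam2 + \<kappa> * (lam2 + \<alpha>2)" and "\<alpha>3 > \<kappa> * \<alpha>4" and "\<kappa> * \<alpha>4 \<ge> 0"
    \<comment> \<open>the threshold is the smallest solution\<close>
    and eps: "\<And>h. eps h = (4 * L + 2 * LR 1) * h + 8 * (\<phi> h)\<^sup>2 * h"
    and "\<Delta>star \<in> {0<..1}"
    and "eps \<Delta>star = (lam1 - \<alpha>1 - 1/4 * lam2 - \<kappa> * (\<alpha>2 + lam2)) / (1 + \<kappa>)"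
    and "\<forall>h\<in>{0<..<\<Delta>star}. eps h \<noteq> (lam1 - \<alpha>1 - 1/4 * lam2 - \<kappa> * (\<alpha>2 + lam2)) / (1 + \<kappa>)"
  shows "\<exists>\<gamma>\<Delta> \<gamma>star.
      \<comment> \<open>the unique roots\<close>
      (\<forall>h\<in>{0<..<\<Delta>star}. \<forall>\<gamma>.
         lam1 = (\<alpha>1 + 1/4 * lam2 + eps h) + \<kappa> * (lam2 + \<alpha>2 + eps h) * exp (\<gamma> * \<tau>)
              + (1 - exp (- \<gamma> * h)) / h
         \<longleftrightarrow> \<gamma> = \<gamma>\<Delta> h) \<and>
      (\<forall>\<gamma>. lam1 = (\<alpha>1 + 1/4 * lam2) + \<kappa> * (lam2 + \<alpha>2) * exp (\<gamma> * \<tau>) + \<gamma> \<longleftrightarrow> \<gamma> = \<gamma>star) \<and>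
      \<gamma>star > 0 \<and>
      (\<gamma>\<Delta> \<longlongrightarrow> \<gamma>star) (at_right 0) \<and>
      (\<forall>h \<xi>. admissible_step \<tau> h \<and> h < \<Delta>star \<and> continuous_on {-\<tau>..0} \<xi> \<longrightarrow>
        (let \<rho> = the_inv_into {0..} \<mu> (\<phi> h);
             y = (\<lambda>k \<omega>. em_scheme (partial_trunc F1 F \<rho>) (partial_trunc G1 G \<rho>)
                           \<delta> \<xi> h (\<lambda>t. B t \<omega>) k);
             Z1 = (\<lambda>t. y \<lfloor>t / h\<rfloor>)
         in limsup (\<lambda>k. ln_ennreal (second_moment M (y (int k))) / ereal (real k * h))
              \<le> - min (ereal (\<gamma>\<Delta> h))
                     (if \<alpha>4 = 0 then \<infinity> else ereal (1 / \<tau> * ln (\<alpha>3 / (\<kappa> * \<alpha>4)))) \<and>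
            (\<integral>\<^sup>+ s\<in>{0..}. second_moment M (Z1 s) \<partial>lborel) < \<infinity>))"
proof -
  interpret prob_space M by (rule assms(1))
  note filt = assms(3) and bm = assms(4)
  have lip1: "(norm (F1 x1 y1 - F1 x2 y2))\<^sup>2 \<le> L * ((norm (x1 - x2))\<^sup>2 + (norm (y1 - y2))\<^sup>2)"
    "(norm (G1 x1 y1 - G1 x2 y2))\<^sup>2 \<le> L * ((norm (x1 - x2))\<^sup>2 + (norm (y1 - y2))\<^sup>2)"
    for x1 x2 y1 y2
    using assms(23) by simp_all
  have lip: "(norm (F x1 y1 - F x2 y2))\<^sup>2 \<le> LR R * ((norm (x1 - x2))\<^sup>2 + (norm (y1 - y2))\<^sup>2)"
    "(norm (G x1 y1 - G x2 y2))\<^sup>2 \<le> LR R * ((norm (x1 - x2))\<^sup>2 + (norm (y1 - y2))\<^sup>2)"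
    if "0 < R" "norm x1 \<le> R" "norm x2 \<le> R" "norm y1 \<le> R" "norm y2 \<le> R" for R x1 x2 y1 y2
    using assms(24) that by simp_all
  have growth1: "(norm (F1 x y))\<^sup>2 \<le> L * ((norm x)\<^sup>2 + (norm y)\<^sup>2)"
    "(norm (G1 x y))\<^sup>2 \<le> L * ((norm x)\<^sup>2 + (norm y)\<^sup>2)" for x y
    using lip1[of x y 0 0] assms(8,10) by simp_all
  have growth: "(norm (F x y))\<^sup>2 \<le> LR R * ((norm x)\<^sup>2 + (norm y)\<^sup>2)"
    "(norm (G x y))\<^sup>2 \<le> LR R * ((norm x)\<^sup>2 + (norm y)\<^sup>2)"
    if "0 < R" "norm x \<le> R" "norm y \<le> R" for R x y
    using lip[of R x 0 y 0] that assms(9,11) by simp_all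
  have L: "0 \<le> L"
    by (rule lipschitz_const_nonneg[of "\<lambda>x. F1 x 0"]) (use lip1(1)[of _ 0 0 0] in simp)
  have LR: "0 \<le> LR R" if "1 \<le> R" for R
    by (rule lipschitz_const_nonneg[of "\<lambda>x. F x 0"]) (use lip(1)[of R _ 0 0 0] that in simp)
  obtain c1 c2 :: real where c: "0 \<le> c1" "0 \<le> c2"
    and diss1: "\<And>x y. 2 * (x \<bullet> F1 x y) + c1 * (norm (G1 x y))\<^sup>2
      \<le> - lam1 * (norm x)\<^sup>2 + lam2 * (norm y)\<^sup>2"
    and diss: "\<And>x y. 2 * (x \<bullet> F x y) + c2 * (norm (G x y))\<^sup>2
      \<le> \<alpha>1 * (norm x)\<^sup>2 + \<alpha>2 * (norm y)\<^sup>2 - \<alpha>3 * norm x powr \<beta> + \<alpha>4 * norm y powr \<beta>"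
    and young: "\<And>x y u v. (norm (G1 x y + G u v))\<^sup>2 \<le> c1 * (norm (G1 x y))\<^sup>2 + c2 * (norm (G u v))\<^sup>2"
    by (rule growth_bound_real_weights[OF assms(25,33,34)]) blast
  have \<kappa>2: "2 \<le> \<kappa>"
  proof -
    have "1 \<le> 1 / (1 - \<delta>hat)" using assms(35,36) by simp
    then have "1 \<le> \<lfloor>1 / (1 - \<delta>hat)\<rfloor>" by simp
    then show ?thesis unfolding \<kappa> by linarith
  qed
  let ?v = "(lam1 - \<alpha>1 - 1/4 * lam2 - \<kappa> * (\<alpha>2 + lam2)) / (1 + \<kappa>)"
  have v: "0 < ?v" using assms(41) \<kappa>2 by (simp add: algebra_simps)
  have \<Delta>: "0 < \<Delta>star" "\<Delta>star \<le> 1" using assms(45) by auto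
  have \<phi>_pos: "0 < \<phi> h" if "0 < h" "h \<le> 1" for h
  proof -
    have "\<mu> 0 < \<mu> 1" using assms(13) by (rule strict_mono_onD) auto
    moreover have "0 \<le> \<mu> 0" using assms(15) by simp
    moreover have "\<mu> 1 \<le> \<phi> h" using assms(19) that by simp
    ultimately show ?thesis by linarith
  qed
  let ?C = "4 * L + 2 * LR 1"
  have C: "0 \<le> ?C" using L LR[of 1] by simp
  have eps_lim: "(eps \<longlongrightarrow> 0) (at_right 0)"
    unfolding eps[abs_def]
    by (rule step_error_tendsto_zero[where H = hhat]) (use \<phi>_pos assms(22) C in \<open>auto intro: less_imp_le\<close>)
  have eps_pos: "0 < eps h" if "0 < h" "h \<le> 1" for h
    unfolding eps using C \<phi>_pos[OF that] that by (intro add_nonneg_pos) auto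
  have eps_less: "eps h < ?v" if "0 < h" "h < \<Delta>star" for h
  proof (rule below_level_before_first_hit[where d = \<Delta>star, OF _ eps_lim v _ that])
    show "eps t \<noteq> ?v" if "0 < t" "t < \<Delta>star" for t using assms(47) that by simp
    \<comment> \<open>\<open>\<epsilon>\<^sub>h / h\<close> decreases in \<open>h\<close> because \<open>\<phi>\<close> does.\<close>
    fix s t :: real assume st: "0 < s" "s \<le> t" "t < \<Delta>star"
    have "\<phi> t \<le> \<phi> s" using assms(20) st \<Delta> by (cases "s = t") (auto intro!: less_imp_le)
    then have "(\<phi> t)\<^sup>2 \<le> (\<phi> s)\<^sup>2" using \<phi>_pos[of t] st \<Delta> by (intro power_mono) auto
    then have "s * t * (?C + 8 * (\<phi> t)\<^sup>2) \<le> s * t * (?C + 8 * (\<phi> s)\<^sup>2)"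
      using st by (intro mult_left_mono) auto
    then show "s * eps t \<le> t * eps s" unfolding eps by (simp add: algebra_simps)
  qed
  have gap: "\<alpha>1 + 1/4 * lam2 + eps h + \<kappa> * (lam2 + \<alpha>2 + eps h) < lam1" if "0 < h" "h < \<Delta>star" for h
    using eps_less[OF that] \<kappa>2 by (simp add: pos_less_divide_eq algebra_simps)

  let ?eq = "\<lambda>h \<gamma>. lam1 = (\<alpha>1 + 1/4 * lam2 + eps h) + \<kappa> * (lam2 + \<alpha>2 + eps h) * exp (\<gamma> * \<tau>)
    + (1 - exp (- \<gamma> * h)) / h"
  let ?limit_eq = "\<lambda>\<gamma>. lam1 = (\<alpha>1 + 1/4 * lam2) + \<kappa> * (lam2 + \<alpha>2) * exp (\<gamma> * \<tau>) + \<gamma>"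
  have coeff_pos: "0 < \<kappa> * (lam2 + \<alpha>2 + eps h)" if "0 < h" "h < \<Delta>star" for h
    using that \<Delta> eps_pos[of h] assms(27,29) \<kappa>2 by (intro mult_pos_pos) auto
  have ex1: "\<exists>!\<gamma>. ?eq h \<gamma>" if "0 < h" "h < \<Delta>star" for h
    by (rule discrete_root_ex1(1)[OF that(1) coeff_pos[OF that] assms(5) gap[OF that]])
  define \<gamma>\<Delta> where "\<gamma>\<Delta> h = (THE \<gamma>. ?eq h \<gamma>)" for h
  have root: "?eq h (\<gamma>\<Delta> h)" if "0 < h" "h < \<Delta>star" for h
    unfolding \<gamma>\<Delta>_def by (rule theI'[OF ex1[OF that]])
  have root_pos: "0 < \<gamma>\<Delta> h" if "0 < h" "h < \<Delta>star" for h
    by (rule discrete_root_ex1(2)[OF that(1) coeff_pos[OF that] assms(5) gap[OF that] root[OF that]])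
  have root_unique: "\<forall>h\<in>{0<..<\<Delta>star}. \<forall>\<gamma>. ?eq h \<gamma> \<longleftrightarrow> \<gamma> = \<gamma>\<Delta> h"
  proof (intro ballI allI iffI)
    fix h \<gamma> assume h: "h \<in> {0<..<\<Delta>star}"
    show "?eq h \<gamma>" if "\<gamma> = \<gamma>\<Delta> h" using root[of h] h unfolding that by simp
    show "\<gamma> = \<gamma>\<Delta> h" if "?eq h \<gamma>"
      unfolding \<gamma>\<Delta>_def by (rule the1_equality[symmetric, OF ex1 that]) (use h in auto)
  qed
  have coeff0: "0 \<le> \<kappa> * (lam2 + \<alpha>2)" using \<kappa>2 assms(27,29) by (intro mult_nonneg_nonneg) auto
  note root0 = continuous_root_ex1[OF coeff0 assms(5) assms(41)]
  define \<gamma>star where "\<gamma>star = (THE \<gamma>. ?limit_eq \<gamma>)"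
  have star: "?limit_eq \<gamma>star" unfolding \<gamma>star_def by (rule theI'[OF root0(1)])
  have star_unique: "\<forall>\<gamma>. ?limit_eq \<gamma> \<longleftrightarrow> \<gamma> = \<gamma>star"
    using ex1E[OF root0(1)] star by blast
  have star_pos: "0 < \<gamma>star" by (rule root0(2)[OF star])
  have limit: "(\<gamma>\<Delta> \<longlongrightarrow> \<gamma>star) (at_right 0)"
  proof (rule discrete_roots_tendsto[where d = \<Delta>star and e = eps])
    show "?eq h (\<gamma>\<Delta> h)" if "0 < h" "h < \<Delta>star" for h by (rule root[OF that])
    show "?limit_eq \<gamma>star" by (rule star)
    show "0 \<le> eps h" if "0 < h" "h < \<Delta>star" for h using eps_pos[of h] that \<Delta> by simp
  qed (use assms(5,27,29) \<kappa>2 \<Delta> eps_lim in auto)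

  have lipschitz_delay: "\<bar>\<delta> s - \<delta> t\<bar> \<le> \<delta>hat * \<bar>s - t\<bar>" if "0 \<le> s" "0 \<le> t" for s t
    using field_differentiable_bound[of "{0..}" \<delta> \<delta>' \<delta>hat s t] assms(38,40) that by auto
  have lam1_L: "lam1\<^sup>2 \<le> 4 * L"
  proof (rule dissipation_square_le_lipschitz[where ?F1.0 = F1])
    show "2 * (x \<bullet> F1 x 0) \<le> - lam1 * (norm x)\<^sup>2" for x
    proof -
      have "0 \<le> c1 * (norm (G1 x 0))\<^sup>2" using c by simp
      then show ?thesis using diss1[of x 0] by simp
    qed
    show "(norm (F1 x 0))\<^sup>2 \<le> L * (norm x)\<^sup>2" for x using growth1(1)[of x 0] by simp
  qed (rule assms(26))

  have scheme: "let \<rho> = the_inv_into {0..} \<mu> (\<phi> h);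
             y = (\<lambda>k \<omega>. em_scheme (partial_trunc F1 F \<rho>) (partial_trunc G1 G \<rho>)
                           \<delta> \<xi> h (\<lambda>t. B t \<omega>) k);
             Z1 = (\<lambda>t. y \<lfloor>t / h\<rfloor>)
         in limsup (\<lambda>k. ln_ennreal (second_moment M (y (int k))) / ereal (real k * h))
              \<le> - min (ereal (\<gamma>\<Delta> h))
                     (if \<alpha>4 = 0 then \<infinity> else ereal (1 / \<tau> * ln (\<alpha>3 / (\<kappa> * \<alpha>4)))) \<and>
            (\<integral>\<^sup>+ s\<in>{0..}. second_moment M (Z1 s) \<partial>lborel) < \<infinity>"
    if adm: "admissible_step \<tau> h" and less: "h < \<Delta>star" for h \<xi>
  proof -
    have h: "0 < h" "h \<le> 1" using adm by (auto simp: admissible_step_def)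
    obtain N where N: "0 < N" "h = \<tau> / real N" using adm by (auto simp: admissible_step_def)
    then have \<tau>: "\<tau> = real N * h" by simp
    define \<rho> where "\<rho> = the_inv_into {0..} \<mu> (\<phi> h)"
    have "\<mu> 1 \<le> \<phi> h" using assms(19) h by simp
    from truncation_radius[OF assms(13,14,16) this]
    have \<rho>: "1 \<le> \<rho>" "\<mu> \<rho> = \<phi> h" by (simp_all add: \<rho>_def)
    have \<rho>0: "0 < \<rho>" using \<rho> by simp
    let ?a = "partial_trunc F1 F \<rho>" and ?b = "partial_trunc G1 G \<rho>"
    let ?e = "eps h"
    interpret driven_scheme M \<F> B ?a ?b \<delta> \<xi> h "2 * (L + LR \<rho>)"
    proof
      have "continuous_on UNIV (\<lambda>p. F1 (fst p) (snd p))" "continuous_on UNIV (\<lambda>p. G1 (fst p) (snd p))"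
        by (rule continuous_on_of_locally_lipschitz[where K = "\<lambda>_. L"]; rule lip1)+
      moreover have "continuous_on UNIV (\<lambda>p. F (fst p) (snd p))" "continuous_on UNIV (\<lambda>p. G (fst p) (snd p))"
        by (rule continuous_on_of_locally_lipschitz[where K = LR]; rule lip; assumption)+
      ultimately show "continuous_on UNIV (\<lambda>p. ?a (fst p) (snd p))"
        "continuous_on UNIV (\<lambda>p. ?b (fst p) (snd p))"
        using \<rho>0 by (auto intro: continuous_partial_trunc)
      show "(norm (?a x y))\<^sup>2 \<le> 2 * (L + LR \<rho>) * ((norm x)\<^sup>2 + (norm y)\<^sup>2)" for x y
        using \<rho>0 LR[OF \<rho>(1)] growth1(1) growth(1)[OF \<rho>0] by (intro partial_trunc_linear_growth)
      show "(norm (?b x y))\<^sup>2 \<le> 2 * (L + LR \<rho>) * ((norm x)\<^sup>2 + (norm y)\<^sup>2)" for x y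
        using \<rho>0 LR[OF \<rho>(1)] growth1(2) growth(2)[OF \<rho>0] by (intro partial_trunc_linear_growth)
    qed (use filt bm h in auto)
    \<comment> \<open>The second member of the minimum is where \<open>\<kappa> \<alpha>\<^sub>4 exp(\<gamma> \<tau>)\<close> reaches \<open>\<alpha>\<^sub>3\<close>.\<close>
    define \<gamma> where "\<gamma> = (if \<alpha>4 = 0 then \<gamma>\<Delta> h else min (\<gamma>\<Delta> h) (1 / \<tau> * ln (\<alpha>3 / (\<kappa> * \<alpha>4))))"
    have ratio: "1 < \<alpha>3 / (\<kappa> * \<alpha>4)" if "\<alpha>4 \<noteq> 0"
      using that assms(31,42) \<kappa>2 by (simp add: less_divide_eq)
    have \<gamma>_pos: "0 < \<gamma>" and \<gamma>_le: "\<gamma> \<le> \<gamma>\<Delta> h"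
      using root_pos[OF h(1) less] ratio assms(5) by (auto simp: \<gamma>_def)
    have balance: "\<kappa> * \<alpha>4 * exp (\<gamma> * \<tau>) \<le> \<alpha>3"
    proof (cases "\<alpha>4 = 0")
      case False
      then have pos: "0 < \<kappa> * \<alpha>4" using assms(31) \<kappa>2 by simp
      have "\<gamma> \<le> 1 / \<tau> * ln (\<alpha>3 / (\<kappa> * \<alpha>4))" using False by (simp add: \<gamma>_def)
      then have "\<gamma> * \<tau> \<le> ln (\<alpha>3 / (\<kappa> * \<alpha>4))" using assms(5) by (simp add: pos_le_divide_eq)
      then have "exp (\<gamma> * \<tau>) \<le> exp (ln (\<alpha>3 / (\<kappa> * \<alpha>4)))" by simp
      also have "\<dots> = \<alpha>3 / (\<kappa> * \<alpha>4)" using ratio[OF False] by simp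
      finally show ?thesis using pos by (simp add: pos_le_divide_eq mult.commute)
    qed (use assms(30) in simp)
    \<comment> \<open>This follows from the characteristic equation at \<open>\<gamma>\<^sub>\<Delta>\<close>, as both \<open>\<gamma>\<close>-dependent terms
      increase in \<open>\<gamma>\<close>.\<close>
    have rate: "\<alpha>1 + ?e + \<kappa> * (lam2 + \<alpha>2 + ?e) * exp (\<gamma> * \<tau>) + (1 - exp (- \<gamma> * h)) / h \<le> lam1"
    proof -
      have "\<kappa> * (lam2 + \<alpha>2 + ?e) * exp (\<gamma> * \<tau>) \<le> \<kappa> * (lam2 + \<alpha>2 + ?e) * exp (\<gamma>\<Delta> h * \<tau>)"
        using \<gamma>_le assms(5) coeff_pos[OF h(1) less] by (intro mult_left_mono) auto
      moreover have "(1 - exp (- \<gamma> * h)) / h \<le> (1 - exp (- \<gamma>\<Delta> h * h)) / h"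
        using strict_mono_mono[OF backward_rate_bounds(1)[OF h(1)], THEN monoD, OF \<gamma>_le] .
      ultimately show ?thesis using root[OF h(1) less] assms(27) by linarith
    qed
    have drift: "h * (norm (?a x y))\<^sup>2 \<le> ?e * ((norm x)\<^sup>2 + (norm y)\<^sup>2)" for x y
    proof -
      have bound: "norm (F1 u w + F u w) \<le> \<phi> h * (1 + norm u + norm w)" if "norm u \<le> \<rho>" "norm w \<le> \<rho>" for u w
      proof -
        have "norm (F1 u w + F u w) / (1 + norm u + norm w) \<le> \<phi> h"
          using assms(17) that \<rho> unfolding f by fastforce
        then show ?thesis by (simp add: pos_divide_le_eq add_pos_nonneg)
      qed
      have "(norm (?a x y))\<^sup>2 \<le> (4 * L + 2 * LR 1 + 8 * (\<phi> h)\<^sup>2) * ((norm x)\<^sup>2 + (norm y)\<^sup>2)"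
        by (rule partial_trunc_drift_bound[OF \<rho>(1) L LR[OF order_refl] _ assms(8) lip1(1) growth(1) bound])
          (use \<phi>_pos[OF h] in auto)
      then have "h * (norm (?a x y))\<^sup>2 \<le> h * ((4 * L + 2 * LR 1 + 8 * (\<phi> h)\<^sup>2) * ((norm x)\<^sup>2 + (norm y)\<^sup>2))"
        using h by (intro mult_left_mono) auto
      also have "\<dots> = ?e * ((norm x)\<^sup>2 + (norm y)\<^sup>2)" unfolding eps by (simp add: algebra_simps)
      finally show ?thesis .
    qed
    \<comment> \<open>The Halanay argument needs a nonnegative coefficient of the present value. It has one
      because \<open>\<lambda>\<^sub>1\<^sup>2 h \<le> 4 L h \<le> \<epsilon>\<^sub>h < \<lambda>\<^sub>1\<close>.\<close>
    have small: "h * lam1 \<le> 1"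
    proof -
      have e0: "0 < ?e" by (rule eps_pos[OF h])
      have "0 \<le> \<kappa> * (lam2 + \<alpha>2 + ?e)" using coeff_pos[OF h(1) less] by simp
      then have "?e < lam1" using gap[OF h(1) less] assms(27,28) by simp
      have "lam1\<^sup>2 * h \<le> ?C * h" using lam1_L LR[of 1] h by (intro mult_right_mono) auto
      also have "\<dots> \<le> ?e" unfolding eps using h by simp
      finally have "lam1 * (h * lam1) \<le> lam1 * 1" using \<open>?e < lam1\<close> by (simp add: power2_eq_square ac_simps)
      then show ?thesis using \<open>?e < lam1\<close> e0 by (simp only: mult_le_cancel_left_pos)
    qed
    have steps: "delay_steps \<delta> h (int k) \<le> N" for k
    proof -
      have "\<delta> (real k * h) \<le> \<tau>" using assms(37) h by simp
      then have "\<delta> (real k * h) / h \<le> real N" using h(1) by (simp add: \<tau> divide_le_eq)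
      then have "\<lfloor>\<delta> (real k * h) / h\<rfloor> \<le> int N" by linarith
      then show ?thesis by (simp add: delay_steps_def nat_le_iff)
    qed
    have fibre: "real (card {k. k < n \<and> int k - int (delay_steps \<delta> h (int k)) = j}) \<le> \<kappa>" for n j
      unfolding \<kappa> using assms(35-37) lipschitz_delay h(1) by (intro delay_fibre_card_le) auto
    obtain K where K: "0 < K"
      and decay: "\<And>k. expectation (\<lambda>\<omega>. (norm (Y (int k) \<omega>))\<^sup>2) \<le> K * exp (- \<gamma> * (real k * h))"
      using truncated_scheme_decay[OF refl refl \<rho>0 \<tau> steps fibre \<kappa>2 c assms(27-29,31)
          less_imp_le[OF \<gamma>_pos] assms(32) diss1 diss young drift less_imp_le[OF eps_pos[OF h]]
          small rate balance] by blast
    have moment: "second_moment M (Y j) = ennreal (expectation (\<lambda>\<omega>. (norm (Y j \<omega>))\<^sup>2))" for j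
      unfolding second_moment_def by (intro nn_integral_eq_integral Y_square_integrable) auto
    have decay': "second_moment M (Y (int k)) \<le> ennreal (K * exp (- \<gamma> * (real k * h)))" for k
      unfolding moment by (rule ennreal_leI[OF decay])
    have "limsup (\<lambda>k. ln_ennreal (second_moment M (Y (int k))) / ereal (real k * h)) \<le> ereal (- \<gamma>)"
      by (rule limsup_ln_le_of_exponential_bound[OF h(1) K decay'])
    also have "ereal (- \<gamma>) = - min (ereal (\<gamma>\<Delta> h))
        (if \<alpha>4 = 0 then \<infinity> else ereal (1 / \<tau> * ln (\<alpha>3 / (\<kappa> * \<alpha>4))))"
      by (simp add: \<gamma>_def min_def)
    finally have "limsup (\<lambda>k. ln_ennreal (second_moment M (Y (int k))) / ereal (real k * h))
      \<le> - min (ereal (\<gamma>\<Delta> h)) (if \<alpha>4 = 0 then \<infinity> else ereal (1 / \<tau> * ln (\<alpha>3 / (\<kappa> * \<alpha>4))))" .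
    moreover have "(\<integral>\<^sup>+ s\<in>{0..}. second_moment M (Y \<lfloor>s / h\<rfloor>) \<partial>lborel) < \<infinity>"
      by (rule step_function_integral_finite[OF h(1) \<gamma>_pos K decay'])
    ultimately show ?thesis unfolding Let_def \<rho>_def[symmetric] Y_def[abs_def] by blast
  qed
  show ?thesis
    by (intro exI[of _ \<gamma>\<Delta>] exI[of _ \<gamma>star] conjI root_unique star_unique star_pos limit allI impI)
      (elim conjE, rule scheme)
qed

end
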